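(* For any $\beta>0$, let $$J_\beta=\Big\{x\in[0,1)\setminus\mathbb{Q}:\ a_{n+1}(x)\ge q_n(x)^{\beta}\ \text{ for infinitely many } n\in\mathbb{N}\Big\},\qquad J^*_\beta=\Big\{x\in J_\beta:\ \lim_{n\to\infty}\frac{\log q_n(x)}{n}=\infty\Big\}.$$ Then $$\dim_H J^*_\beta=\frac{1}{2+\beta},$$ i.e. the Hausdorff dimension of $J^*_\beta$ is one half of the Hausdorff dimension of $J_\beta$.
   Context: $\mathbb{N}=\{1,2,3,\dots\}$. The Gauss transformation $T:[0,1)\to[0,1)$ is $T(0)=0$, $T(x)=1/x\pmod 1$ for $x\in(0,1)$. For irrational $x\in[0,1)$, the partial quotients of $x$ are $a_1(x)=\lfloor 1/x\rfloor$ and $a_n(x)=a_1(T^{n-1}(x))$ for $n\ge2$, so $x=[a_1(x),a_2(x),\dots]$. The denominators $q_n(x)$ of the convergents are given by $q_{-1}=0$, $q_0=1$, $q_n(x)=a_n(x)q_{n-1}(x)+q_{n-2}(x)$ for $n\ge1$. $\dim_H$ denotes Hausdorff dimension. *)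

theory Defs
  imports "HOL-Analysis.Analysis"
begin

text \<open>
  The size of one covering set, \<open>|U|\<^sup>s\<close> with the usual conventions \<open>|\<emptyset>|\<^sup>s = 0\<close> and \<open>|U|\<^sup>0 = 1\<close>
  for \<open>U \<noteq> \<emptyset>\<close>; the case \<open>s = 0\<close> is separate because \<open>0 powr 0 = 0\<close> in HOL.
\<close>
definition diam_pow :: "real \<Rightarrow> 'a::metric_space set \<Rightarrow> ennreal" where
  "diam_pow s U = (if U = {} then 0 else if s = 0 then 1 else ennreal (diameter U powr s))"

text \<open>Boundedness is required because \<open>diameter\<close> is unspecified on unbounded sets.\<close>
definition hausdorff_premeasure :: "real \<Rightarrow> real \<Rightarrow> 'a::metric_space set \<Rightarrow> ennreal" where
  "hausdorff_premeasure s \<delta> A =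
     (INF U \<in> {U :: nat \<Rightarrow> 'a set. (\<forall>i. bounded (U i) \<and> diameter (U i) \<le> \<delta>) \<and> A \<subseteq> (\<Union>i. U i)}.
        \<Sum>i. diam_pow s (U i))"

definition hausdorff_measure :: "real \<Rightarrow> 'a::metric_space set \<Rightarrow> ennreal" where
  "hausdorff_measure s A = (SUP \<delta> \<in> {0<..}. hausdorff_premeasure s \<delta> A)"

definition hausdorff_dim :: "'a::metric_space set \<Rightarrow> ennreal" where
  "hausdorff_dim A = Inf {ennreal s | s. 0 \<le> s \<and> hausdorff_measure s A = 0}"

definition gauss_map :: "real \<Rightarrow> real" where
  "gauss_map x = (if x = 0 then 0 else frac (1 / x))"

text \<open>Only the values at indices \<open>n \<ge> 1\<close> are meaningful.\<close>
definition partial_quotient :: "nat \<Rightarrow> real \<Rightarrow> nat" where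
  "partial_quotient n x = nat \<lfloor>1 / (gauss_map ^^ (n - 1)) x\<rfloor>"

text \<open>The recurrence with \<open>q\<^sub>-\<^sub>1 = 0\<close> and \<open>q\<^sub>0 = 1\<close>, unrolled once to avoid the index \<open>-1\<close>.\<close>
fun cf_denom :: "nat \<Rightarrow> real \<Rightarrow> nat" where
  "cf_denom 0 x = 1"
| "cf_denom (Suc 0) x = partial_quotient 1 x"
| "cf_denom (Suc (Suc n)) x =
     partial_quotient (Suc (Suc n)) x * cf_denom (Suc n) x + cf_denom n x"

definition J :: "real \<Rightarrow> real set" where
  "J \<beta> = {x \<in> {0..<1} - \<rat>.
     infinite {n. 1 \<le> n \<and> real (partial_quotient (n + 1) x) \<ge> real (cf_denom n x) powr \<beta>}}"

definition J_star :: "real \<Rightarrow> real set" where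
  "J_star \<beta> = {x \<in> J \<beta>. filterlim (\<lambda>n. ln (real (cf_denom n x)) / real n) at_top sequentially}"

end

theory Submission
  imports Defs "HOL-Real_Asymp.Real_Asymp"
begin

text \<open>
  Write \<open>q\<^sub>n\<close> for the denominators of the convergents \<open>p\<^sub>n / q\<^sub>n\<close> of \<open>x\<close>. Since
  \<open>\<bar>x - p\<^sub>n / q\<^sub>n\<bar>\<close> is about \<open>1 / (a\<^sub>n\<^sub>+\<^sub>1 q\<^sub>n\<^sup>2)\<close>, the condition \<open>a\<^sub>n\<^sub>+\<^sub>1 \<ge> q\<^sub>n\<^sup>\<beta>\<close> puts \<open>x\<close> within
  \<open>q\<^sub>n powr - (2 + \<beta>)\<close> of \<open>p\<^sub>n / q\<^sub>n\<close>. Every point of the two sets lies in infinitely many such balls, and the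
  dimension is decided by how many rationals of a given size can occur as centres.

  For \<open>J \<beta>\<close> all reduced fractions occur, up to \<open>q\<close> of them with denominator \<open>q\<close>, and the covering sum
  \<open>\<Sum>q * q powr - ((2 + \<beta>) * s)\<close> converges exactly for \<open>s > 2 / (2 + \<beta>)\<close>
  (\<open>hausdorff_measure_J_zero\<close>). For \<open>J_star \<beta>\<close> only digit strings \<open>a\<^sub>1, \<dots>, a\<^sub>n\<close> with
  \<open>q\<^sub>n \<ge> M\<^sup>n\<close> matter, for any \<open>M\<close>. If \<open>(2 + \<beta>) * s = 1 + 2 * \<eta>\<close> with \<open>\<eta> > 0\<close>, then \<open>q\<^sub>n \<ge> a\<^sub>1 \<cdots> a\<^sub>n\<close>
  bounds the sum over strings of length \<open>n\<close>, up to a constant, by \<open>(\<zeta>(1 + \<eta>) / M\<^sup>\<eta>)\<^sup>n\<close>, which is a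
  geometric sequence with small ratio when \<open>M\<close> is large. This is why the critical exponent drops
  to \<open>1 / (2 + \<beta>)\<close> (\<open>hausdorff_measure_J_star_zero\<close>): the superexponential growth makes the number of
  digits negligible, and the sum behaves as if there were boundedly many strings per denominator.

  The lower bounds come from Cantor sets inside the two sets. In \<open>J_star \<beta>\<close> every digit
  \<open>a\<^sub>n\<^sub>+\<^sub>1\<close> is chosen among about \<open>q\<^sub>n\<^sup>\<beta>\<close> values comparable to \<open>q\<^sub>n\<^sup>\<beta>\<close>; each cylinder of order \<open>n\<close>
  then carries mass about \<open>1 / q\<^sub>n\<close> on a set of length about \<open>q\<^sub>n powr - (2 + \<beta>)\<close>
  (\<open>hausdorff_measure_J_star_nonzero\<close>). In \<open>J \<beta>\<close> the intervals of one level are balls of radius about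
  \<open>N powr - (2 + \<beta>)\<close> around reduced fractions with denominators between \<open>4 N\<close> and \<open>5 N\<close>. Every interval
  contains a number of such fractions proportional to its length times \<open>N\<^sup>2\<close> once \<open>N\<close> is
  large (\<open>fracs_bounds\<close>), so a ball carries mass about \<open>N powr - 2\<close> (\<open>hausdorff_measure_J_nonzero\<close>);
  Legendre's theorem (\<open>legendre_convergent\<close>) turns the centres into convergents of the limit point.

  Both Cantor sets are treated by one mass distribution principle,
  \<open>separated_tree_hausdorff_measure_nonzero\<close>. Its proof builds no measure: assuming a cheap cover, it
  walks down the tree, always moving to a child on which the cover remains too cheap for the
  mass of that child, and reaches a point that no set of the cover contains.
\<close>

section \<open>Hausdorff measure and dimension\<close>

lemma powr_le_diam_pow: "ennreal (diameter U powr s) \<le> diam_pow s U"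
  by (auto simp: diam_pow_def diameter_def powr_le1)

lemma diam_pow_pos: "s > 0 \<Longrightarrow> diam_pow s U = ennreal (diameter U powr s)"
  by (auto simp: diam_pow_def diameter_def)

text \<open>
  No mesh condition is needed: for \<open>s > 0\<close> a small sum of \<open>s\<close>-th powers already forces every
  single diameter to be small. Bounding finite partial sums lets covers be indexed by any countable type.
\<close>
lemma hausdorff_measure_zeroI:
  fixes A :: "'a::metric_space set"
  assumes s: "s > 0"
    and cover: "\<And>e. e > 0 \<Longrightarrow> \<exists>U :: 'i::countable \<Rightarrow> 'a set. (\<forall>i. bounded (U i)) \<and> A \<subseteq> (\<Union>i. U i) \<and>
                 (\<forall>F. finite F \<longrightarrow> (\<Sum>i\<in>F. diameter (U i) powr s) \<le> e)"
  shows "hausdorff_measure s A = 0"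
proof -
  have "hausdorff_premeasure s \<delta> A \<le> ennreal e" if \<delta>: "\<delta> > 0" and e0: "e > 0" for \<delta> e
  proof -
    \<comment> \<open>A sum of at most \<open>\<delta> powr s\<close> keeps each diameter below \<open>\<delta>\<close>.\<close>
    define e' where "e' = min e (\<delta> powr s)"
    have "e' > 0" using \<delta> e0 by (simp add: e'_def)
    from cover[OF this] obtain U :: "'i \<Rightarrow> 'a set" where
      bd: "\<And>i. bounded (U i)" and sub: "A \<subseteq> (\<Union>i. U i)" and
      fin: "\<And>F. finite F \<Longrightarrow> (\<Sum>i\<in>F. diameter (U i) powr s) \<le> e'" by auto
    define V where "V n = (if n \<in> range (to_nat :: 'i \<Rightarrow> nat) then U (from_nat n) else {})" for n
    have dU: "diameter (U i) \<le> \<delta>" for i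
    proof -
      have "diameter (U i) powr s \<le> \<delta> powr s" using fin[of "{i}"] by (simp add: e'_def)
      then show ?thesis using s \<delta> diameter_ge_0[OF bd]
        by (meson not_le powr_less_mono2 less_imp_le)
    qed
    have "\<forall>i. bounded (V i) \<and> diameter (V i) \<le> \<delta>"
      using bd dU \<delta> by (auto simp: V_def)
    moreover have "A \<subseteq> (\<Union>i. V i)"
    proof
      fix x assume "x \<in> A"
      then obtain i where "x \<in> U i" using sub by auto
      then have "x \<in> V (to_nat i)" by (simp add: V_def)
      then show "x \<in> (\<Union>i. V i)" by blast
    qed
    ultimately have "hausdorff_premeasure s \<delta> A \<le> (\<Sum>i. diam_pow s (V i))"
      unfolding hausdorff_premeasure_def by (intro INF_lower) auto
    also have "\<dots> \<le> ennreal e'"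
    proof (rule suminf_le_const[OF summableI])
      fix n
      let ?N = "{..<n} \<inter> range (to_nat :: 'i \<Rightarrow> nat)"
      let ?F = "(from_nat :: nat \<Rightarrow> 'i) ` ?N"
      have inj: "inj_on (from_nat :: nat \<Rightarrow> 'i) ?N" by (auto simp: inj_on_def)
      have "(\<Sum>i<n. diam_pow s (V i)) = (\<Sum>i\<in>?N. diam_pow s (V i))"
        by (rule sum.mono_neutral_right) (auto simp: V_def diam_pow_def)
      also have "\<dots> = (\<Sum>i\<in>?N. ennreal (diameter (U (from_nat i)) powr s))"
        by (rule sum.cong) (auto simp: V_def diam_pow_pos s)
      also have "\<dots> = (\<Sum>i\<in>?F. ennreal (diameter (U i) powr s))"
        using inj by (simp add: sum.reindex)
      also have "\<dots> = ennreal (\<Sum>i\<in>?F. diameter (U i) powr s)"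
        by (rule sum_ennreal) simp
      also have "\<dots> \<le> ennreal e'"
        using fin[of ?F] by (intro ennreal_leI) auto
      finally show "(\<Sum>i<n. diam_pow s (V i)) \<le> ennreal e'" .
    qed
    also have "\<dots> \<le> ennreal e" by (auto simp: e'_def intro: ennreal_leI)
    finally show ?thesis .
  qed
  then have "hausdorff_premeasure s \<delta> A = 0" if "\<delta> > 0" for \<delta>
    using that by (metis ennreal_le_epsilon add_0 le_zero_eq)
  then show ?thesis
    unfolding hausdorff_measure_def by (simp add: SUP_eq_const)
qed

lemma hausdorff_dim_leI:
  assumes "0 \<le> s0" "\<And>s. s > s0 \<Longrightarrow> hausdorff_measure s A = 0"
  shows "hausdorff_dim A \<le> ennreal s0"
proof (rule ennreal_le_epsilon)
  fix e :: real assume e: "0 < e"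
  have "hausdorff_dim A \<le> ennreal (s0 + e)"
    unfolding hausdorff_dim_def by (intro Inf_lower CollectI exI[of _ "s0 + e"]) (use assms e in auto)
  also have "\<dots> = ennreal s0 + ennreal e" using assms e by simp
  finally show "hausdorff_dim A \<le> ennreal s0 + ennreal e" .
qed

lemma hausdorff_dim_geI:
  assumes "\<And>s. 0 \<le> s \<Longrightarrow> s < s0 \<Longrightarrow> hausdorff_measure s A \<noteq> 0"
  shows "ennreal s0 \<le> hausdorff_dim A"
  unfolding hausdorff_dim_def
proof (rule Inf_greatest)
  fix t assume "t \<in> {ennreal s |s. 0 \<le> s \<and> hausdorff_measure s A = 0}"
  then obtain s where "t = ennreal s" "0 \<le> s" "hausdorff_measure s A = 0" by auto
  with assms[of s] show "ennreal s0 \<le> t" by (cases "s < s0") (auto intro: ennreal_leI)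
qed

section \<open>A mass distribution principle for trees of compact sets\<close>

text \<open>
  The nodes satisfying \<open>G\<close> carry compact sets \<open>I v\<close> and masses \<open>W v\<close> that are split equally among
  the children. The hypothesis \<open>spread\<close> is the Frostman condition \<open>\<mu>(U) \<le> C * diameter U powr s\<close>,
  demanded only at the level where \<open>U\<close> first meets two children.

  Suppose that sets \<open>U i\<close> of total cost less than \<open>W r / C\<close> cover the limit set. Charge a node with
  the sum of \<open>min (c i) (W v / C)\<close> over the sets \<open>U i\<close> that meet \<open>I v\<close>. Replacing a node by all
  its children does not increase the total charge: a set meeting one child is charged once, with a
  smaller cap, and a set meeting several children is charged at most \<open>c i\<close> by \<open>spread\<close> and at most
  \<open>W v / C\<close> by the caps. Hence the strict inequality between the charge and \<open>W v / C\<close> passes to some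
  child. Along the resulting branch \<open>W\<close> tends to \<open>0\<close>, so a set containing the
  limit point would have cost \<open>0\<close>, while all costs are made positive beforehand.
\<close>
lemma tree_hausdorff_measure_nonzero:
  fixes I :: "'v \<Rightarrow> real set" and W :: "'v \<Rightarrow> real"
  assumes root: "G r" "W r > 0" and C: "C > 0" and s: "s \<ge> 0"
    and cpt: "\<And>v. G v \<Longrightarrow> compact (I v) \<and> I v \<noteq> {}"
    and fin: "\<And>v. G v \<Longrightarrow> finite (ch v) \<and> 2 \<le> card (ch v)"
    and child: "\<And>v c. G v \<Longrightarrow> c \<in> ch v \<Longrightarrow> G c \<and> I c \<subseteq> I v \<and> W c = W v / card (ch v)"
    and spread: "\<And>v U. G v \<Longrightarrow> W v > 0 \<Longrightarrow> bounded U \<Longrightarrow> 2 \<le> card {c\<in>ch v. I c \<inter> U \<noteq> {}} \<Longrightarrow>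
        real (card {c\<in>ch v. I c \<inter> U \<noteq> {}}) * (W v / card (ch v)) \<le> C * diameter U powr s"
    and limit: "\<And>v x. v 0 = r \<Longrightarrow> (\<And>k. G (v k)) \<Longrightarrow> (\<And>k. v (Suc k) \<in> ch (v k)) \<Longrightarrow>
        (\<And>k. x \<in> I (v k)) \<Longrightarrow> x \<in> E"
  shows "hausdorff_measure s E \<noteq> 0"
proof
  assume "hausdorff_measure s E = 0"
  then have "hausdorff_premeasure s 1 E = 0"
    unfolding hausdorff_measure_def
    by (metis SUP_upper greaterThan_iff le_zero_eq zero_less_one)
  moreover have pos: "0 < W r / (2 * C)" using root C by simp
  ultimately have "hausdorff_premeasure s 1 E < ennreal (W r / (2 * C))" by simp
  then obtain U :: "nat \<Rightarrow> real set" where bd: "\<And>i. bounded (U i)" and sub: "E \<subseteq> (\<Union>i. U i)"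
    and sumU: "(\<Sum>i. diam_pow s (U i)) < ennreal (W r / (2 * C))"
    unfolding hausdorff_premeasure_def INF_less_iff by auto
  define \<epsilon> where "\<epsilon> = W r / (2 * C)"
  have \<epsilon>: "\<epsilon> > 0" using pos by (simp add: \<epsilon>_def)
  \<comment> \<open>The extra summand makes the cost of a singleton positive.\<close>
  define c where "c i = diameter (U i) powr s + \<epsilon> * (1/2) ^ Suc i" for i
  have cpos: "c i > 0" for i using \<epsilon> by (simp add: c_def add_nonneg_pos)
  have "(\<Sum>i. ennreal (diameter (U i) powr s)) \<le> (\<Sum>i. diam_pow s (U i))"
    by (intro suminf_le powr_le_diam_pow summableI)
  with sumU have lt: "(\<Sum>i. ennreal (diameter (U i) powr s)) < ennreal \<epsilon>"
    by (simp add: \<epsilon>_def)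
  have sm1: "summable (\<lambda>i. diameter (U i) powr s)"
    by (rule summable_suminf_not_top) (use lt in auto)
  have su1: "(\<Sum>i. diameter (U i) powr s) < \<epsilon>"
  proof -
    have "(\<Sum>i. ennreal (diameter (U i) powr s)) = ennreal (\<Sum>i. diameter (U i) powr s)"
      by (rule suminf_ennreal2[OF _ sm1]) simp
    then show ?thesis using lt suminf_nonneg[OF sm1] by (simp add: ennreal_less_iff)
  qed
  have sums2: "(\<lambda>i. \<epsilon> * (1/2) ^ Suc i) sums (\<epsilon> * 1)"
    by (rule sums_mult[OF power_half_series])
  have smc: "summable c" unfolding c_def
    by (intro summable_add sm1) (use sums2 sums_summable in blast)
  have "suminf c = (\<Sum>i. diameter (U i) powr s) + \<epsilon>"
    unfolding c_def using suminf_add[OF sm1 sums_summable[OF sums2]] sums_unique[OF sums2] by simp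
  then have suc: "suminf c < W r / C" using su1 by (simp add: \<epsilon>_def field_simps)

  \<comment> \<open>The charge of \<open>U i\<close> at the node \<open>v\<close>, capped by the mass available there.\<close>
  define f where "f v i = (if I v \<inter> U i \<noteq> {} then min (c i) (W v / C) else 0)" for v i
  have f_bounds: "0 \<le> f v i \<and> f v i \<le> c i" if "W v > 0" for v i
    using that C cpos[of i] by (auto simp: f_def min_def)
  have smf: "summable (f v)" if "W v > 0" for v
    by (rule summable_comparison_test'[OF smc, of 0]) (use f_bounds[OF that] in auto)
  define P where "P v \<longleftrightarrow> G v \<and> W v > 0 \<and> suminf (f v) < W v / C" for v
  have Pr: "P r"
    unfolding P_def using root suc suminf_le[OF _ smf smc, of r] f_bounds by force
  have step: "\<exists>w. P w \<and> w \<in> ch v" if "P v" for v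
  proof -
    have G: "G v" and W: "W v > 0" and S: "suminf (f v) < W v / C" using that by (auto simp: P_def)
    define m where "m = card (ch v)"
    have m: "m \<ge> 2" and fc: "finite (ch v)" using fin[OF G] by (auto simp: m_def)
    have Wc: "W w = W v / m" if "w \<in> ch v" for w using child[OF G that] by (simp add: m_def)
    have Wc0: "W w > 0" if "w \<in> ch v" for w using Wc[OF that] W m by simp
    have key: "(\<Sum>w\<in>ch v. f w i) \<le> f v i" for i
    proof -
      define H where "H = {w\<in>ch v. I w \<inter> U i \<noteq> {}}"
      have fH: "finite H" and Hm: "card H \<le> m" using fc by (auto simp: H_def m_def intro: card_mono)
      have eq: "(\<Sum>w\<in>ch v. f w i) = (\<Sum>w\<in>H. min (c i) (W v / m / C))"
        unfolding H_def using fc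
        by (intro sum.mono_neutral_cong_right) (auto simp: f_def Wc)
      show ?thesis
      proof (cases "H = {}")
        case True
        then show ?thesis using eq f_bounds[OF W, of i] by simp
      next
        case False
        then have hit: "I v \<inter> U i \<noteq> {}" using child[OF G] by (auto simp: H_def)
        have k1: "card H \<ge> 1" using False fH by (simp add: Suc_leI card_gt_0_iff)
        have "(\<Sum>w\<in>H. min (c i) (W v / m / C)) \<le> card H * (W v / m / C)"
          by (rule sum_bounded_above) simp
        also have "\<dots> \<le> m * (W v / m / C)"
          using Hm W C by (intro mult_right_mono) auto
        also have "\<dots> = W v / C" using m by simp
        finally have le1: "(\<Sum>w\<in>H. min (c i) (W v / m / C)) \<le> W v / C" .
        have le2: "(\<Sum>w\<in>H. min (c i) (W v / m / C)) \<le> c i"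
        proof (cases "card H \<ge> 2")
          case True
          have "(\<Sum>w\<in>H. min (c i) (W v / m / C)) \<le> card H * (W v / m / C)"
            by (rule sum_bounded_above) simp
          also have "\<dots> = card H * (W v / m) / C" by simp
          also have "\<dots> \<le> diameter (U i) powr s"
            using spread[OF G W bd[of i]] True C unfolding H_def[symmetric] m_def[symmetric]
            by (simp add: pos_divide_le_eq mult.commute del: divide_divide_eq_left times_divide_eq_right)
          also have "\<dots> \<le> c i" using \<epsilon> by (simp add: c_def)
          finally show ?thesis .
        next
          case False
          with k1 have "card H = 1" by simp
          then show ?thesis by simp
        qed
        show ?thesis using le1 le2 eq hit by (simp add: f_def)
      qed
    qed
    have "(\<Sum>w\<in>ch v. suminf (f w)) = (\<Sum>i. \<Sum>w\<in>ch v. f w i)"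
      by (rule suminf_sum[symmetric]) (use smf Wc0 in auto)
    also have "\<dots> \<le> suminf (f v)"
      by (intro suminf_le key smf[OF W] summable_sum) (use smf Wc0 in auto)
    also have "\<dots> < W v / C" by (rule S)
    also have "\<dots> = (\<Sum>w\<in>ch v. W v / m / C)" using m by (simp add: m_def)
    finally have "\<exists>w\<in>ch v. suminf (f w) < W v / m / C"
      by (meson not_le sum_mono)
    then obtain w where w: "w \<in> ch v" "suminf (f w) < W w / C" using Wc by auto
    then show ?thesis using child[OF G] Wc0 unfolding P_def by blast
  qed
  obtain v where v0: "v 0 = r" and v: "\<And>k. P (v k)" and ch: "\<And>k. v (Suc k) \<in> ch (v k)"
    using dependent_nat_choice[of "\<lambda>k v. P v \<and> (k = 0 \<longrightarrow> v = r)" "\<lambda>_ v w. w \<in> ch v"] Pr step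
    by auto
  have G: "G (v k)" for k using v P_def by blast
  have sub1: "I (v (Suc k)) \<subseteq> I (v k)" for k using child[OF G ch] by blast
  have "\<Inter> (range (\<lambda>k. I (v k))) \<noteq> {}"
    by (rule compact_nest) (use cpt[OF G] lift_Suc_antimono_le[of "\<lambda>k. I (v k)", OF sub1] in auto)
  then obtain x where x: "\<And>k. x \<in> I (v k)" by auto
  have "x \<in> E" by (rule limit[of v]) (use v0 G ch x in auto)
  then obtain j where j: "x \<in> U j" using sub by auto
  \<comment> \<open>The charge of \<open>U j\<close> stays strictly below the cap, so it is \<open>c j\<close> itself.\<close>
  have small: "c j < W (v k) / C" for k
  proof -
    have Wk: "W (v k) > 0" using v P_def by blast
    have "I (v k) \<inter> U j \<noteq> {}" using x j by blast
    then have "min (c j) (W (v k) / C) = f (v k) j" by (simp add: f_def)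
    also have "\<dots> = sum (f (v k)) {j}" by simp
    also have "\<dots> \<le> suminf (f (v k))"
      by (rule sum_le_suminf) (use smf[OF Wk] f_bounds[OF Wk] in auto)
    also have "\<dots> < W (v k) / C" using v P_def by blast
    finally show ?thesis by (simp add: min_def split: if_splits)
  qed
  have decay: "W (v k) \<le> W r * (1/2) ^ k" for k
  proof (induction k)
    case 0 then show ?case using v0 by simp
  next
    case (Suc k)
    have "2 \<le> card (ch (v k))" "W (v k) > 0" using fin[OF G] v P_def by auto
    then have "W (v k) / card (ch (v k)) \<le> W (v k) / 2" by (intro divide_left_mono) auto
    moreover have "W (v (Suc k)) = W (v k) / card (ch (v k))" using child[OF G ch] by blast
    ultimately have "W (v (Suc k)) \<le> W (v k) / 2" by simp
    then show ?case using Suc by simp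
  qed
  have "(\<lambda>k. W r * (1/2) ^ k / C) \<longlonglongrightarrow> W r * 0 / C"
    by (intro tendsto_intros) (use C in auto)
  then have "eventually (\<lambda>k. W r * (1/2) ^ k / C < c j) sequentially"
    using cpos[of j] by (intro order_tendstoD(2)) auto
  then obtain k where "W r * (1/2) ^ k / C < c j" by (auto simp: eventually_sequentially)
  moreover have "W (v k) / C \<le> W r * (1/2) ^ k / C"
    using decay C by (intro divide_right_mono) auto
  ultimately show False using small[of k] by simp
qed

lemma separated_card_le:
  fixes X :: "real set"
  assumes "finite X" "X \<noteq> {}" and g: "g > 0"
    and sep: "\<And>x y. x \<in> X \<Longrightarrow> y \<in> X \<Longrightarrow> x \<noteq> y \<Longrightarrow> g \<le> \<bar>x - y\<bar>"
    and diam: "\<And>x y. x \<in> X \<Longrightarrow> y \<in> X \<Longrightarrow> \<bar>x - y\<bar> \<le> d"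
  shows "real (card X) \<le> d / g + 1"
proof -
  define u where "u = Min X"
  have u: "u \<in> X" "\<And>x. x \<in> X \<Longrightarrow> u \<le> x" using assms by (auto simp: u_def)
  \<comment> \<open>Half-open cells of length \<open>g\<close> contain at most one point each.\<close>
  define h where "h x = \<lfloor>(x - u) / g\<rfloor>" for x
  have inj: "inj_on h X"
  proof (rule inj_onI, rule ccontr)
    fix x y assume *: "x \<in> X" "y \<in> X" "h x = h y" "x \<noteq> y"
    have "\<bar>(x - u) / g - (y - u) / g\<bar> < 1" using *(3) unfolding h_def by linarith
    moreover have "(x - u) / g - (y - u) / g = (x - y) / g" by (simp add: diff_divide_distrib)
    ultimately have "\<bar>x - y\<bar> < g" using g by (simp add: abs_divide)
    with sep * show False by fastforce
  qed
  have "h ` X \<subseteq> {0..\<lfloor>d / g\<rfloor>}"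
  proof
    fix z assume "z \<in> h ` X"
    then obtain x where x: "x \<in> X" "z = h x" by auto
    have "(x - u) / g \<le> d / g" using diam[OF x(1) u(1)] g by (intro divide_right_mono) auto
    then show "z \<in> {0..\<lfloor>d / g\<rfloor>}" using x u(2)[of x] g by (auto simp: h_def intro: floor_mono)
  qed
  then have "card (h ` X) \<le> card {0..\<lfloor>d / g\<rfloor>}" by (intro card_mono) auto
  then have le: "card X \<le> nat (\<lfloor>d / g\<rfloor> + 1)" using card_image[OF inj] by simp
  have "0 \<le> d / g" using diam[OF u(1) u(1)] g by simp
  then show ?thesis using le by linarith
qed

text \<open>
  If distinct children are at distance at least \<open>gap v\<close>, a set of diameter \<open>d\<close> meeting at least two
  of them meets at most \<open>2 * d / gap v\<close>. The hypothesis \<open>weight\<close> then says that the mass of \<open>v\<close> is at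
  most the \<open>s\<close>-th power of the length \<open>gap v * card (ch v)\<close> over which the children are spread.
\<close>
lemma separated_tree_hausdorff_measure_nonzero:
  fixes I :: "'v \<Rightarrow> real set" and W gap :: "'v \<Rightarrow> real"
  assumes root: "G r" "W r > 0" and C: "C > 0" and s: "0 \<le> s" "s \<le> 1"
    and cpt: "\<And>v. G v \<Longrightarrow> compact (I v) \<and> I v \<noteq> {}"
    and fin: "\<And>v. G v \<Longrightarrow> finite (ch v) \<and> 2 \<le> card (ch v)"
    and child: "\<And>v c. G v \<Longrightarrow> c \<in> ch v \<Longrightarrow> G c \<and> I c \<subseteq> I v \<and> W c = W v / card (ch v)"
    and gap: "\<And>v. G v \<Longrightarrow> gap v > 0"
    and sep: "\<And>v b c x y. G v \<Longrightarrow> b \<in> ch v \<Longrightarrow> c \<in> ch v \<Longrightarrow> b \<noteq> c \<Longrightarrow> x \<in> I b \<Longrightarrow> y \<in> I c \<Longrightarrow>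
        gap v \<le> \<bar>x - y\<bar>"
    and weight: "\<And>v. G v \<Longrightarrow> W v \<le> C * (gap v * card (ch v)) powr s"
    and limit: "\<And>v x. v 0 = r \<Longrightarrow> (\<And>k. G (v k)) \<Longrightarrow> (\<And>k. v (Suc k) \<in> ch (v k)) \<Longrightarrow>
        (\<And>k. x \<in> I (v k)) \<Longrightarrow> x \<in> E"
  shows "hausdorff_measure s E \<noteq> 0"
proof (rule tree_hausdorff_measure_nonzero[where G = G and r = r and W = W and I = I and ch = ch
      and C = "C * 2 powr s"])
  fix v U assume G: "G v" and W: "W v > 0" and bd: "bounded U"
    and two: "2 \<le> card {c\<in>ch v. I c \<inter> U \<noteq> {}}"
  define H where "H = {c\<in>ch v. I c \<inter> U \<noteq> {}}"
  define m where "m = card (ch v)"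
  define d where "d = diameter U"
  have m: "m \<ge> 2" and fc: "finite (ch v)" using fin[OF G] by (auto simp: m_def)
  have fH: "finite H" and Hm: "card H \<le> m" using fc by (auto simp: H_def m_def intro: card_mono)
  define pt where "pt c = (SOME x. x \<in> I c \<inter> U)" for c
  have pt: "pt c \<in> I c" "pt c \<in> U" if "c \<in> H" for c
  proof -
    have "pt c \<in> I c \<inter> U" unfolding pt_def by (rule someI_ex) (use that H_def in auto)
    then show "pt c \<in> I c" "pt c \<in> U" by auto
  qed
  have g: "gap v > 0" by (rule gap[OF G])
  have far: "gap v \<le> \<bar>pt b - pt c\<bar>" if "b \<in> H" "c \<in> H" "b \<noteq> c" for b c
    using sep[OF G] that pt H_def by blast
  have inj: "inj_on pt H" using far g by (force simp: inj_on_def)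
  have near: "\<bar>pt b - pt c\<bar> \<le> d" if "b \<in> H" "c \<in> H" for b c
    using diameter_bounded_bound[OF bd pt(2)[OF that(1)] pt(2)[OF that(2)]]
    by (simp add: d_def dist_real_def)
  have "card H \<noteq> 0" using two by (simp add: H_def)
  then have "H \<noteq> {}" by auto
  then have "real (card (pt ` H)) \<le> d / gap v + 1"
    by (intro separated_card_le) (use fH g far near in auto)
  then have k: "real (card H) \<le> d / gap v + 1" using card_image[OF inj] by simp
  moreover have k2: "2 \<le> real (card H)" using two by (simp add: H_def)
  ultimately have "1 \<le> d / gap v" by simp
  with k have k': "real (card H) \<le> 2 * d / gap v" by simp
  have d: "d > 0" using \<open>1 \<le> d / gap v\<close> g by (simp add: field_simps)
  define \<theta> where "\<theta> = real (card H) / m"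
  have \<theta>: "0 < \<theta>" "\<theta> \<le> 1" using k2 Hm m by (auto simp: \<theta>_def)
  \<comment> \<open>The proportion \<open>\<theta>\<close> of children met is at most 1 and at most \<open>2 d / (gap m)\<close>,
      hence at most the \<open>s\<close>-th power of the latter.\<close>
  have "\<theta> = \<theta> powr 1" using \<theta> by simp
  also have "\<dots> \<le> \<theta> powr s" using \<theta> s by (intro powr_mono') auto
  also have "\<dots> \<le> (2 * d / (gap v * m)) powr s"
  proof (rule powr_mono2)
    have "\<theta> \<le> (2 * d / gap v) / m" unfolding \<theta>_def using k' by (intro divide_right_mono) auto
    then show "\<theta> \<le> 2 * d / (gap v * m)" by simp
  qed (use s \<theta> in auto)
  finally have "\<theta> \<le> (2 * d / (gap v * m)) powr s" .
  then have "\<theta> * W v \<le> (2 * d / (gap v * m)) powr s * (C * (gap v * m) powr s)"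
    using weight[OF G] W \<theta> by (intro mult_mono) (auto simp: m_def)
  also have "\<dots> = C * (2 * d / (gap v * m) * (gap v * m)) powr s"
    using g d m by (subst powr_mult) auto
  also have "\<dots> = C * (2 * d) powr s" using g m by simp
  also have "\<dots> = C * 2 powr s * d powr s" using d by (simp add: powr_mult)
  finally show "real (card {c\<in>ch v. I c \<inter> U \<noteq> {}}) * (W v / real (card (ch v)))
      \<le> C * 2 powr s * diameter U powr s"
    by (simp add: \<theta>_def H_def m_def d_def mult.commute)
qed (fact root cpt fin child limit | use C s in simp)+

section \<open>Continued fractions\<close>

text \<open>
  Convergents of an arbitrary digit sequence \<open>a 1, a 2, \<dots>\<close>; the value \<open>a 0\<close> is never read. Carrying the
  previous convergent along as a second function keeps the index \<open>-1\<close> available, where the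
  convergent is \<open>1 / 0\<close>.
\<close>
fun num num_prev :: "(nat \<Rightarrow> nat) \<Rightarrow> nat \<Rightarrow> nat" where
  "num a 0 = 0"
| "num a (Suc n) = a (Suc n) * num a n + num_prev a n"
| "num_prev a 0 = 1"
| "num_prev a (Suc n) = num a n"

fun den den_prev :: "(nat \<Rightarrow> nat) \<Rightarrow> nat \<Rightarrow> nat" where
  "den a 0 = 1"
| "den a (Suc n) = a (Suc n) * den a n + den_prev a n"
| "den_prev a 0 = 0"
| "den_prev a (Suc n) = den a n"

lemma cf_denom_eq_den: "cf_denom n x = den (\<lambda>i. partial_quotient i x) n"
proof (induction n x rule: cf_denom.induct)
  case (3 n x)
  then show ?case by (cases n) auto
qed auto

lemma convergent_cong:
  assumes "\<And>i. 1 \<le> i \<Longrightarrow> i \<le> n \<Longrightarrow> a i = b i"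
  shows "num a n = num b n \<and> num_prev a n = num_prev b n \<and> den a n = den b n \<and> den_prev a n = den_prev b n"
  using assms by (induction n) auto

lemma convergent_det:
  "int (num a n) * int (den_prev a n) - int (num_prev a n) * int (den a n) = (-1) ^ Suc n"
  by (induction n) (auto simp: algebra_simps)

lemma prod_le_den: "(\<Prod>i=1..n. a i) \<le> den a n"
  by (induction n) (auto simp: trans_le_add1 mult.commute)

lemma moebius_diff:
  fixes p p' q q' t u :: real
  assumes "q + q' * t \<noteq> 0" "q + q' * u \<noteq> 0"
  shows "(p + p' * t) / (q + q' * t) - (p + p' * u) / (q + q' * u) =
    (p' * q - p * q') * (t - u) / ((q + q' * t) * (q + q' * u))"
  using assms by (simp add: divide_simps) (simp add: algebra_simps)

text \<open>
  An expansion of \<open>x\<close> with digits \<open>a\<close> and complete remainders \<open>t\<close>. For irrational \<open>x\<close> the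
  remainders are the Gauss orbit (\<open>irrational_cf_expansion\<close>); conversely any such data come from an
  irrational \<open>x\<close> and determine its partial quotients (\<open>partial_quotient_eq\<close>), which is how points of
  a Cantor set are recognised.
\<close>
locale cf_expansion =
  fixes x :: real and a :: "nat \<Rightarrow> nat" and t :: "nat \<Rightarrow> real"
  assumes t_0: "t 0 = x"
    and t_bounds: "0 < t n" "t n < 1"
    and t_Suc: "t n = 1 / (real (a (Suc n)) + t (Suc n))"
    and digit_pos: "1 \<le> a (Suc n)"
begin

lemma den_pos: "1 \<le> den a n" and den_prev_le: "den_prev a n \<le> den a n"
proof -
  have "1 \<le> den a n \<and> den_prev a n \<le> den a n"
  proof (induction n)
    case (Suc n)
    have "den a n \<le> a (Suc n) * den a n" using digit_pos[of n] by simp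
    then show ?case using Suc unfolding den.simps den_prev.simps by linarith
  qed auto
  then show "1 \<le> den a n" "den_prev a n \<le> den a n" by auto
qed

lemma den_mono: "m \<le> n \<Longrightarrow> den a m \<le> den a n"
  using lift_Suc_mono_le[of "den a" m n] den_prev_le[of "Suc n" for n] by simp

lemma den_less: "1 \<le> n \<Longrightarrow> den a n < den a (Suc n)"
proof -
  assume "1 \<le> n"
  then obtain m where n: "n = Suc m" by (cases n) auto
  have "den a n \<le> a (Suc n) * den a n" using digit_pos[of n] by simp
  moreover have "den_prev a n \<ge> 1" using den_pos[of m] by (simp add: n)
  ultimately show ?thesis unfolding den.simps by linarith
qed

lemma den_ge: "n \<le> den a n"
proof (induction n)
  case (Suc n)
  show ?case
  proof (cases "n = 0")
    case True
    then show ?thesis using den_pos[of 1] by simp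
  next
    case False
    then show ?thesis using den_less[of n] Suc by simp
  qed
qed auto

lemma value_moebius: "x * (den a n + den_prev a n * t n) = num a n + num_prev a n * t n"
proof (induction n)
  case 0 then show ?case using t_0 by simp
next
  case (Suc n)
  have pos: "real (a (Suc n)) + t (Suc n) \<noteq> 0" using t_bounds(1)[of "Suc n"] by (simp add: add_nonneg_pos)
  let ?s = "real (a (Suc n)) + t (Suc n)"
  have "t n * ?s = 1" using t_Suc[of n] pos by simp
  have "x * (den a n + den_prev a n * t n) * ?s = (num a n + num_prev a n * t n) * ?s"
    using Suc by simp
  then have "x * (den a n * ?s + den_prev a n * (t n * ?s)) = num a n * ?s + num_prev a n * (t n * ?s)"
    by (simp only: distrib_right mult.assoc)
  then have "x * (den a n * ?s + den_prev a n) = num a n * ?s + num_prev a n"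
    using \<open>t n * ?s = 1\<close> by simp
  then show ?case by (simp add: algebra_simps)
qed

lemma dist_convergent:
  "\<bar>x - num a n / den a n\<bar> = t n / (den a n * (den a n + den_prev a n * t n))"
proof -
  let ?D = "real (den a n) + den_prev a n * t n"
  have d: "real (den a n) > 0" using den_pos[of n] by simp
  have D: "?D > 0" using d t_bounds(1)[of n] by (intro add_pos_nonneg) auto
  have x: "x = (num a n + num_prev a n * t n) / ?D"
    using value_moebius[of n] D by (simp add: field_simps)
  have "x - num a n / den a n = (real (num_prev a n) * den a n - real (num a n) * den_prev a n) * t n / (?D * den a n)"
    using moebius_diff[of "den a n" "den_prev a n" "t n" 0 "num a n" "num_prev a n"] D d
    by (simp add: x)
  also have "real (num_prev a n) * den a n - real (num a n) * den_prev a n = - real_of_int ((-1) ^ Suc n)"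
    unfolding convergent_det[of a n, symmetric] by simp
  finally show ?thesis
    using D d t_bounds(1)[of n] by (simp add: abs_mult abs_divide mult.commute)
qed

lemma dist_convergent_le: "\<bar>x - num a n / den a n\<bar> \<le> 1 / (a (Suc n) * (den a n)\<^sup>2)"
proof -
  have d: "real (den a n) > 0" using den_pos[of n] by simp
  have ap: "real (a (Suc n)) > 0" using digit_pos[of n] by simp
  have "t n / (den a n * (den a n + den_prev a n * t n)) \<le> (1 / a (Suc n)) / (den a n * den a n)"
  proof (rule frac_le)
    have "t n \<le> 1 / (real (a (Suc n)))"
      unfolding t_Suc[of n] using t_bounds(1)[of "Suc n"] ap by (intro divide_left_mono) auto
    then show "t n \<le> 1 / (real (a (Suc n)))" .
    show "real (den a n * den a n) \<le> den a n * (den a n + den_prev a n * t n)"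
      using t_bounds(1)[of n] d by (simp add: algebra_simps)
  qed (use d t_bounds(1)[of n] in auto)
  then show ?thesis by (simp add: dist_convergent power2_eq_square)
qed

lemma dist_convergent_ge: "1 / ((real (a (Suc n)) + 2) * (real (den a n))\<^sup>2) \<le> \<bar>x - num a n / den a n\<bar>"
proof -
  have d: "real (den a n) > 0" using den_pos[of n] by simp
  have tn: "0 < t n" "t n < 1" using t_bounds by auto
  have a2: "1 + t n \<le> (real (a (Suc n)) + 2) * t n"
  proof -
    have "t n * (a (Suc n) + t (Suc n)) = 1"
      using t_Suc[of n] t_bounds(1)[of "Suc n"] by (simp add: add_nonneg_pos add_nonneg_eq_0_iff)
    moreover have "t n * t (Suc n) \<le> t n * 1" using tn t_bounds(2)[of "Suc n"] by (intro mult_left_mono) auto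
    ultimately show ?thesis by (simp add: algebra_simps)
  qed
  have gen: "1 / (A * B) = t n / (A * t n * B)" for A B :: real using tn by simp
  have "1 / ((real (a (Suc n)) + 2) * (real (den a n))\<^sup>2) = t n / ((real (a (Suc n)) + 2) * t n * (real (den a n))\<^sup>2)"
    using gen .
  also have "\<dots> \<le> t n / ((1 + t n) * (real (den a n))\<^sup>2)"
    using tn d a2 by (intro divide_left_mono mult_right_mono) auto
  also have "\<dots> \<le> t n / (den a n * (den a n + den_prev a n * t n))"
  proof (rule divide_left_mono)
    have "den_prev a n * t n \<le> den a n * t n"
      using den_prev_le[of n] tn by (intro mult_right_mono) auto
    then have "real (den a n) * (den a n + den_prev a n * t n) \<le> den a n * (den a n + den a n * t n)"
      by (intro mult_left_mono) auto
    then show "real (den a n) * (den a n + den_prev a n * t n) \<le> (1 + t n) * (real (den a n))\<^sup>2"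
      by (simp add: algebra_simps power2_eq_square)
    show "0 < (1 + t n) * (real (den a n))\<^sup>2 * (den a n * (den a n + den_prev a n * t n))"
      using d tn by (auto intro!: mult_pos_pos add_pos_nonneg)
  qed (use tn in auto)
  finally show ?thesis by (simp add: dist_convergent)
qed

lemma num_le_den: "num a n \<le> den a n"
proof -
  have d: "real (den a n) \<ge> 1" using den_pos[of n] by simp
  have x1: "x < 1" using t_0 t_bounds(2)[of 0] by simp
  have "\<bar>x - num a n / den a n\<bar> \<le> 1 / (den a n)"
    unfolding dist_convergent
  proof (rule frac_le)
    have "1 * 1 \<le> real (den a n) + den_prev a n * t n" using d t_bounds(1)[of n]
      by (simp add: add_increasing2)
    then have "real (den a n) * 1 \<le> den a n * (den a n + den_prev a n * t n)"
      using d by (intro mult_left_mono) auto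
    then show "real (den a n) \<le> den a n * (den a n + den_prev a n * t n)" by simp
  qed (use d t_bounds[of n] in \<open>auto intro: less_imp_le\<close>)
  then have "num a n / den a n < 1 + 1 / den a n" using x1 by linarith
  then have "real (num a n) < den a n + 1" using d by (simp add: field_simps)
  then show ?thesis by linarith
qed

lemma exists_den_bracket:
  assumes "1 \<le> q"
  shows "\<exists>n. den a n \<le> q \<and> q < den a (Suc n)"
proof -
  define N where "N = {n. den a n \<le> q}"
  have "N \<subseteq> {..q}" using den_ge order_trans by (auto simp: N_def)
  then have fin: "finite N" by (rule finite_subset) auto
  have "0 \<in> N" using assms by (simp add: N_def)
  then have "Max N \<in> N" using fin by (intro Max_in) auto
  moreover have "Suc (Max N) \<notin> N" using Max_ge[OF fin] not_less_eq_eq by blast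
  ultimately show ?thesis by (auto simp: N_def)
qed

text \<open>
  With \<open>q\<^sub>n \<le> q < q\<^sub>n\<^sub>+\<^sub>1\<close>, write \<open>D\<close> and \<open>E\<close> for the determinants of \<open>p / q\<close> with the convergents of
  order \<open>n\<close> and \<open>n + 1\<close>. Then \<open>q = \<bar>q\<^sub>n\<^sub>+\<^sub>1 D - q\<^sub>n E\<bar>\<close>, so \<open>D \<noteq> 0\<close> forces \<open>D\<close> and \<open>E\<close> to have the
  same sign and \<open>\<bar>E\<bar>\<close> to be at least \<open>(q\<^sub>n\<^sub>+\<^sub>1 - q) / q\<^sub>n\<close>. There is no cancellation in
  \<open>q x - p = - (E + D t) / (q\<^sub>n\<^sub>+\<^sub>1 + q\<^sub>n t)\<close>, and its size would exceed \<open>1 / (2 q)\<close>. Hence \<open>D = 0\<close>.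
\<close>
theorem legendre_convergent:
  fixes p q :: int
  assumes q: "q > 0" and cop: "coprime p q"
    and close: "\<bar>x - p / q\<bar> < 1 / (2 * real_of_int q ^ 2)"
  shows "\<exists>n. int (num a n) = p \<and> int (den a n) = q"
proof -
  have "1 \<le> nat q" using q by linarith
  then obtain n where "den a n \<le> nat q" "nat q < den a (Suc n)"
    using exists_den_bracket by blast
  then have n: "int (den a n) \<le> q" "q < int (den a (Suc n))" using q by linarith+
  define Q where "Q = den a (Suc n)"
  define P where "P = num a (Suc n)"
  define D where "D = p * int (den a n) - q * int (num a n)"
  define E where "E = p * int Q - q * int P"
  define s where "s = t (Suc n)"
  have s: "0 < s" "s < 1" using t_bounds by (auto simp: s_def)
  have dn: "real (den a n) \<ge> 1" using den_pos[of n] by simp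
  have "1 \<le> Q" using den_pos[of "Suc n"] by (simp only: Q_def)
  then have QP: "real Q > 0" by simp
  have "int P * int (den a n) - int (num a n) * int Q = (-1) ^ Suc (Suc n)"
    using convergent_det[of a "Suc n"] by (simp add: P_def Q_def)
  moreover have "int Q * D - int (den a n) * E = q * (int P * int (den a n) - int (num a n) * int Q)"
    by (simp add: D_def E_def algebra_simps)
  ultimately have comb: "\<bar>int Q * D - int (den a n) * E\<bar> = q" using q by (simp add: abs_mult)
  have "D = 0"
  proof (rule ccontr)
    assume "D \<noteq> 0"
    have sgn: "D * E > 0"
    proof (rule ccontr)
      assume "\<not> D * E > 0"
      then have "D \<ge> 1 \<and> E \<le> 0 \<or> D \<le> -1 \<and> E \<ge> 0"
        using \<open>D \<noteq> 0\<close> by (smt (verit) zero_less_mult_iff)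
      then have "\<bar>int Q * D - int (den a n) * E\<bar> \<ge> int Q"
      proof
        assume "D \<ge> 1 \<and> E \<le> 0"
        then have "int Q * 1 \<le> int Q * D" "int (den a n) * E \<le> 0"
          by (intro mult_left_mono; simp) (simp add: mult_nonneg_nonpos \<open>D \<ge> 1 \<and> E \<le> 0\<close>)
        then show ?thesis by simp
      next
        assume "D \<le> -1 \<and> E \<ge> 0"
        then have "int Q * D \<le> int Q * (-1)" "int (den a n) * E \<ge> 0"
          by (intro mult_left_mono; simp) (simp add: \<open>D \<le> -1 \<and> E \<ge> 0\<close>)
        then show ?thesis by simp
      qed
      then show False using comb n(2) by (simp add: Q_def)
    qed
    then have E0: "E \<noteq> 0" by auto
    have absED: "\<bar>real_of_int E + D * s\<bar> = \<bar>real_of_int E\<bar> + \<bar>real_of_int D\<bar> * s"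
    proof (cases "D > 0")
      case True
      then have "E > 0" using sgn by (simp add: zero_less_mult_iff)
      then show ?thesis using True s by simp
    next
      case False
      then have "E < 0" "D < 0" using sgn by (auto simp: zero_less_mult_iff)
      then have "real_of_int E < 0" "real_of_int D < 0" by auto
      then have "real_of_int E + D * s < 0" using s by (simp add: add_neg_neg mult_neg_pos)
      then show ?thesis using \<open>real_of_int E < 0\<close> \<open>real_of_int D < 0\<close> by simp
    qed
    have D1: "\<bar>real_of_int D\<bar> \<ge> 1" "\<bar>real_of_int E\<bar> \<ge> 1" using \<open>D \<noteq> 0\<close> E0 by linarith+
    have "int Q * \<bar>D\<bar> - int (den a n) * \<bar>E\<bar> \<le> q"
      using comb abs_triangle_ineq2[of "int Q * D" "int (den a n) * E"] by (simp add: abs_mult)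
    moreover have "int Q * 1 \<le> int Q * \<bar>D\<bar>" using \<open>D \<noteq> 0\<close> by (intro mult_left_mono) auto
    ultimately have "int Q - q \<le> int (den a n) * \<bar>E\<bar>" by simp
    then have "real_of_int (int Q - q) \<le> real_of_int (int (den a n) * \<bar>E\<bar>)"
      by (simp only: of_int_le_iff)
    then have Ege: "real Q - q \<le> den a n * \<bar>real_of_int E\<bar>" by simp
    let ?M = "real Q + den a n * s"
    have M: "?M > 0" using QP s by (intro add_pos_nonneg) auto
    have "x * ?M = P + num a n * s"
      using value_moebius[of "Suc n"] by (simp add: Q_def P_def s_def)
    then have "q * (x * ?M) - p * ?M = q * (P + num a n * s) - p * ?M" by simp
    also have "\<dots> = - (real_of_int E + D * s)" by (simp add: D_def E_def algebra_simps)
    finally have eqM: "(q * x - p) * ?M = - (real_of_int E + D * s)"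
      by (simp only: left_diff_distrib mult.assoc)
    have "\<bar>q * x - p\<bar> * ?M = \<bar>(q * x - p) * ?M\<bar>" using M by (simp only: abs_mult abs_of_pos)
    also have "\<dots> = \<bar>real_of_int E\<bar> + \<bar>real_of_int D\<bar> * s"
      by (simp only: eqM abs_minus_cancel absED)
    also have "\<dots> \<ge> \<bar>real_of_int E\<bar> + s"
      using D1 s by simp
    finally have lower: "\<bar>q * x - p\<bar> * ?M \<ge> \<bar>real_of_int E\<bar> + s" .
    have "\<bar>q * x - p\<bar> = q * \<bar>x - p / q\<bar>"
    proof -
      have "q * x - p = q * (x - p / q)" using q by (simp add: field_simps)
      then show ?thesis using q by (simp add: abs_mult)
    qed
    also have "\<dots> < q * (1 / (2 * real_of_int q ^ 2))"
      using close q by (intro mult_strict_left_mono) auto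
    also have "\<dots> = 1 / (2 * q)" using q by (simp add: power2_eq_square)
    finally have "\<bar>q * x - p\<bar> * ?M < 1 / (2 * q) * ?M" using M by (intro mult_strict_right_mono)
    with lower have "\<bar>real_of_int E\<bar> + s < ?M / (2 * q)" by simp
    then have upper: "2 * q * (\<bar>real_of_int E\<bar> + s) < ?M" using q by (simp add: field_simps)
    have q1: "real (den a n) \<le> q" using n(1) by linarith
    have s1: "den a n * s \<le> 2 * q * s" using q1 q s by (intro mult_right_mono) auto
    \<comment> \<open>For large \<open>Q\<close> the bound \<open>Ege\<close> decides, otherwise \<open>\<bar>E\<bar> \<ge> 1\<close> is enough.\<close>
    have "2 * q * \<bar>real_of_int E\<bar> \<ge> Q"
    proof (cases "Q \<ge> 2 * q")
      case True
      have "real Q / 2 \<le> Q - q" using True by linarith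
      also have "\<dots> \<le> den a n * \<bar>real_of_int E\<bar>" using Ege by simp
      also have "\<dots> \<le> q * \<bar>real_of_int E\<bar>" using q1 by (intro mult_right_mono) auto
      finally show ?thesis by simp
    next
      case False
      then have "real Q \<le> 2 * real_of_int q * 1" by linarith
      also have "\<dots> \<le> 2 * real_of_int q * \<bar>real_of_int E\<bar>" using D1 q by (intro mult_left_mono) auto
      finally show ?thesis by simp
    qed
    then show False using upper s1 by (simp add: distrib_left)
  qed
  then have eq: "p * int (den a n) = q * int (num a n)" by (simp add: D_def)
  have "q dvd p * int (den a n)" using eq by simp
  then have "q dvd int (den a n)" using cop by (metis coprime_commute coprime_dvd_mult_right_iff)
  moreover have "0 < int (den a n)" using den_pos[of n] by simp
  ultimately have "q \<le> int (den a n)" by (rule zdvd_imp_le)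
  then have "int (den a n) = q" using n(1) by simp
  moreover from this eq have "p = int (num a n)" using q by simp
  ultimately show ?thesis by blast
qed

end

lemma gauss_map_irrational:
  assumes "x \<notin> \<rat>" "0 < x" "x < 1"
  shows "gauss_map x \<notin> \<rat>" "0 < gauss_map x" "gauss_map x < 1"
    "x = 1 / (real (nat \<lfloor>1 / x\<rfloor>) + gauss_map x)" "1 \<le> nat \<lfloor>1 / x\<rfloor>"
proof -
  have g: "gauss_map x = frac (1 / x)" using assms by (simp add: gauss_map_def)
  have f1: "1 \<le> \<lfloor>1 / x\<rfloor>" using assms by simp
  show "1 \<le> nat \<lfloor>1 / x\<rfloor>" by (metis f1 nat_mono nat_one_as_int)
  have e: "real (nat \<lfloor>1 / x\<rfloor>) + gauss_map x = 1 / x"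
    using of_nat_nat[of "\<lfloor>1 / x\<rfloor>", where ?'a = real] f1 by (simp only: g frac_def)
  then show "x = 1 / (real (nat \<lfloor>1 / x\<rfloor>) + gauss_map x)" by simp
  show irr: "gauss_map x \<notin> \<rat>"
  proof
    assume "gauss_map x \<in> \<rat>"
    then have "real (nat \<lfloor>1 / x\<rfloor>) + gauss_map x \<in> \<rat>" by (intro Rats_add) auto
    then have "1 / x \<in> \<rat>" by (simp only: e)
    then have "inverse (1 / x) \<in> \<rat>" by (rule Rats_inverse)
    then show False using assms by simp
  qed
  then have "gauss_map x \<noteq> 0" by auto
  then show "0 < gauss_map x" "gauss_map x < 1"
    using g frac_lt_1[of "1 / x"] frac_ge_0[of "1 / x"] by linarith+
qed

lemma irrational_cf_expansion:
  assumes "x \<in> {0..<1} - \<rat>"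
  shows "cf_expansion x (\<lambda>i. partial_quotient i x) (\<lambda>n. (gauss_map ^^ n) x)"
proof -
  have x: "x \<notin> \<rat>" "0 < x" "x < 1" using assms by (auto simp: order_less_le)
  have orbit: "(gauss_map ^^ n) x \<notin> \<rat> \<and> 0 < (gauss_map ^^ n) x \<and> (gauss_map ^^ n) x < 1" for n
    by (induction n) (use x gauss_map_irrational in auto)
  show ?thesis
  proof
    fix n
    show "0 < (gauss_map ^^ n) x" "(gauss_map ^^ n) x < 1" using orbit by auto
    show "(gauss_map ^^ n) x = 1 / (real (partial_quotient (Suc n) x) + (gauss_map ^^ Suc n) x)"
      using gauss_map_irrational(4)[of "(gauss_map ^^ n) x"] orbit[of n] by (simp add: partial_quotient_def)
    show "1 \<le> partial_quotient (Suc n) x"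
      using gauss_map_irrational(5)[of "(gauss_map ^^ n) x"] orbit[of n] by (simp add: partial_quotient_def)
  qed simp
qed

text \<open>The Gauss map performs one division step of the Euclidean algorithm.\<close>
lemma rational_gauss_orbit_zero: "m < n \<Longrightarrow> \<exists>k. (gauss_map ^^ k) (real m / real n) = 0"
proof (induction m arbitrary: n rule: less_induct)
  case (less m)
  show ?case
  proof (cases "m = 0")
    case True
    then show ?thesis by (auto intro: exI[of _ 0])
  next
    case False
    have "1 / (real m / real n) = real n / real m" by simp
    moreover have "real n / real m = real (n div m) + real (n mod m) / real m"
      using False by (simp add: field_simps flip: of_nat_mult of_nat_add)
    moreover have "frac (real (n div m) + real (n mod m) / real m) = real (n mod m) / real m"
      using False by (simp add: frac_unique_iff)
    ultimately have "gauss_map (real m / real n) = real (n mod m) / real m"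
      using False less.prems by (simp add: gauss_map_def)
    moreover obtain k where "(gauss_map ^^ k) (real (n mod m) / real m) = 0"
      using less.IH[of "n mod m" m] False by auto
    ultimately have "(gauss_map ^^ Suc k) (real m / real n) = 0"
      by (simp add: funpow_Suc_right del: funpow.simps)
    then show ?thesis by blast
  qed
qed

context cf_expansion
begin

lemma gauss_iterate: "(gauss_map ^^ n) x = t n"
proof (induction n)
  case 0 then show ?case using t_0 by simp
next
  case (Suc n)
  have "gauss_map (t n) = frac (real (a (Suc n)) + t (Suc n))"
    using t_Suc[of n] t_bounds[of n] by (simp add: gauss_map_def)
  also have "\<dots> = t (Suc n)" using t_bounds[of "Suc n"] by (simp add: frac_unique_iff)
  finally show ?case using Suc by simp
qed

lemma partial_quotient_eq: "partial_quotient (Suc n) x = a (Suc n)"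
proof -
  have "1 / t n = real (a (Suc n)) + t (Suc n)" using t_Suc[of n] by simp
  then have "\<lfloor>1 / t n\<rfloor> = int (a (Suc n))" using t_bounds[of "Suc n"] by (simp add: floor_eq_iff)
  then show ?thesis by (simp add: partial_quotient_def gauss_iterate)
qed

lemma cf_denom_eq: "cf_denom n x = den a n"
proof -
  have "den (\<lambda>i. partial_quotient i x) n = den a n"
  proof (rule convergent_cong[THEN conjunct2, THEN conjunct2, THEN conjunct1])
    fix i :: nat assume "1 \<le> i"
    then show "partial_quotient i x = a i" using partial_quotient_eq[of "i - 1"] by simp
  qed
  then show ?thesis by (simp add: cf_denom_eq_den)
qed

lemma irrational: "x \<in> {0..<1} - \<rat>"
proof -
  have x: "0 < x" "x < 1" using t_0 t_bounds[of 0] by auto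
  have "x \<notin> \<rat>"
  proof
    assume "x \<in> \<rat>"
    then obtain m n where mn: "n \<noteq> 0" "\<bar>x\<bar> = real m / real n" by (elim Rats_abs_nat_div_natE)
    have "x * real n < 1 * real n" using x mn(1) by (intro mult_strict_right_mono) auto
    moreover have "real m = x * real n" using mn x by simp
    ultimately have "m < n" by linarith
    then obtain k where "(gauss_map ^^ k) x = 0" using rational_gauss_orbit_zero mn x by fastforce
    then show False using t_bounds(1)[of k] by (simp add: gauss_iterate)
  qed
  then show ?thesis using x by simp
qed

end

section \<open>Upper bounds\<close>

lemma convergent_close:
  assumes x: "x \<in> {0..<1} - \<rat>"
    and big: "real (cf_denom n x) powr \<beta> \<le> partial_quotient (Suc n) x"
  defines "a \<equiv> \<lambda>i. partial_quotient i x"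
  shows "\<bar>x - num a n / den a n\<bar> \<le> real (den a n) powr - (2 + \<beta>)"
proof -
  interpret cf_expansion x a "\<lambda>n. (gauss_map ^^ n) x"
    unfolding a_def by (rule irrational_cf_expansion[OF x])
  have d: "real (den a n) > 0" using den_pos[of n] by simp
  have "\<bar>x - num a n / den a n\<bar> \<le> 1 / (a (Suc n) * (real (den a n))\<^sup>2)"
    using dist_convergent_le[of n] by simp
  also have "\<dots> \<le> 1 / (real (den a n) powr \<beta> * (real (den a n))\<^sup>2)"
  proof (rule divide_left_mono)
    show "real (den a n) powr \<beta> * (real (den a n))\<^sup>2 \<le> a (Suc n) * (real (den a n))\<^sup>2"
      using big by (intro mult_right_mono) (auto simp: a_def cf_denom_eq_den)
    show "0 < real (a (Suc n)) * (real (den a n))\<^sup>2 * (real (den a n) powr \<beta> * (real (den a n))\<^sup>2)"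
      using d digit_pos[of n] by simp
  qed simp
  also have "\<dots> = real (den a n) powr - (2 + \<beta>)"
  proof -
    have "real (den a n) powr (2 + \<beta>) = (real (den a n))\<^sup>2 * real (den a n) powr \<beta>"
      using d by (simp add: powr_add powr_numeral)
    then show ?thesis by (simp only: powr_minus_divide mult.commute)
  qed
  finally show ?thesis .
qed

lemma ball_powr:
  fixes q \<beta> s :: real
  shows "(2 * q powr - (2 + \<beta>)) powr s = 2 powr s * q powr - ((2 + \<beta>) * s)"
  by (simp add: powr_mult powr_powr algebra_simps)

lemma hausdorff_measure_J_zero:
  assumes \<beta>: "\<beta> > 0" and s: "s > 2 / (2 + \<beta>)"
  shows "hausdorff_measure s (J \<beta>) = 0"
proof (rule hausdorff_measure_zeroI[where 'i = "nat \<times> nat"])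
  have "0 < 2 / (2 + \<beta>)" using \<beta> by simp
  then show s0: "s > 0" using s by linarith
  fix e :: real assume e: "e > 0"
  define \<tau> where "\<tau> = (2 + \<beta>) * s"
  have \<tau>: "\<tau> > 2" using s \<beta> by (simp add: \<tau>_def field_simps)
  define f where "f q = 2 * 2 powr s * real q powr (1 - \<tau>)" for q
  have "summable f" unfolding f_def using \<tau> by (intro summable_mult) (simp add: summable_real_powr_iff)
  then obtain Q where Q: "\<And>m n. m \<ge> Q \<Longrightarrow> norm (sum f {m..<n}) < e"
    using e unfolding summable_Cauchy by blast
  \<comment> \<open>The maximum excludes \<open>q = 0\<close>, where \<open>p / q\<close> would be meaningless.\<close>
  define U where "U = (\<lambda>(q::nat, p::nat). if max Q 1 \<le> q \<and> p \<le> q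
    then cball (real p / q) (real q powr - (2 + \<beta>)) else {})"
  have "\<forall>i. bounded (U i)" by (auto simp: U_def)
  moreover have "J \<beta> \<subseteq> (\<Union>i. U i)"
  proof
    fix x assume xJ: "x \<in> J \<beta>"
    then have x: "x \<in> {0..<1} - \<rat>"
      and inf: "infinite {n. 1 \<le> n \<and> real (cf_denom n x) powr \<beta> \<le> partial_quotient (n + 1) x}"
      by (auto simp: J_def)
    define a where "a = (\<lambda>i. partial_quotient i x)"
    interpret cf_expansion x a "\<lambda>n. (gauss_map ^^ n) x"
      unfolding a_def by (rule irrational_cf_expansion[OF x])
    obtain n where n: "n \<ge> Q" "real (cf_denom n x) powr \<beta> \<le> partial_quotient (Suc n) x"
      using inf unfolding infinite_nat_iff_unbounded_le by auto
    have "x \<in> U (den a n, num a n)"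
      using convergent_close[OF x n(2)] den_ge[of n] den_pos[of n] num_le_den[of n] n(1)
      by (auto simp: U_def a_def[symmetric] dist_real_def abs_minus_commute)
    then show "x \<in> (\<Union>i. U i)" by blast
  qed
  moreover have "(\<Sum>i\<in>F. diameter (U i) powr s) \<le> e" if "finite F" for F
  proof -
    define M where "M = Suc (Max (insert 0 (fst ` F)))"
    define S where "S = Sigma {max Q 1..<M} (\<lambda>q. {..q})"
    have "(\<Sum>i\<in>F. diameter (U i) powr s) = (\<Sum>i\<in>F \<inter> S. diameter (U i) powr s)"
    proof (rule sum.mono_neutral_right)
      have "q < M" if "(q, p) \<in> F" for q p
        unfolding M_def less_Suc_eq_le using \<open>finite F\<close> that by (intro Max_ge) (auto intro: rev_image_eqI)
      then show "\<forall>i\<in>F - F \<inter> S. diameter (U i) powr s = 0"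
        by (auto simp: S_def U_def split: if_splits)
    qed (use that in auto)
    also have "\<dots> \<le> (\<Sum>i\<in>S. diameter (U i) powr s)"
      by (rule sum_mono2) (auto simp: S_def)
    also have "\<dots> = (\<Sum>q=max Q 1..<M. \<Sum>p\<le>q. diameter (U (q, p)) powr s)"
      unfolding S_def by (subst sum.Sigma) auto
    also have "\<dots> \<le> (\<Sum>q=max Q 1..<M. f q)"
    proof (rule sum_mono)
      fix q assume q: "q \<in> {max Q 1..<M}"
      have "(\<Sum>p\<le>q. diameter (U (q, p)) powr s) = (\<Sum>p\<le>q. 2 powr s * real q powr - \<tau>)"
      proof (intro sum.cong refl)
        fix p assume "p \<in> {..q}"
        then have "U (q, p) = cball (real p / real q) (real q powr - (2 + \<beta>))"
          using q by (simp add: U_def)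
        then show "diameter (U (q, p)) powr s = 2 powr s * real q powr - \<tau>"
          unfolding \<tau>_def ball_powr[symmetric] by (simp add: diameter_cball)
      qed
      also have "\<dots> = (1 + real q) * (2 powr s * real q powr - \<tau>)" by simp
      also have "\<dots> \<le> (2 * real q) * (2 powr s * real q powr - \<tau>)"
        using q by (intro mult_right_mono) auto
      also have "\<dots> = f q"
        using q by (simp add: f_def powr_diff powr_minus_divide)
      finally show "(\<Sum>p\<le>q. diameter (U (q, p)) powr s) \<le> f q" .
    qed
    also have "\<dots> \<le> e" using Q[of "max Q 1" M] by simp
    finally show ?thesis .
  qed
  ultimately show "\<exists>U :: nat \<times> nat \<Rightarrow> real set. (\<forall>i. bounded (U i)) \<and> J \<beta> \<subseteq> (\<Union>i. U i) \<and>
      (\<forall>F. finite F \<longrightarrow> (\<Sum>i\<in>F. diameter (U i) powr s) \<le> e)" by blast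
qed

text \<open>
  Expanding the power: this is what makes the sum over all digit strings of length \<open>n\<close> the
  \<open>n\<close>-th power of a zeta sum.
\<close>
lemma sum_prod_list:
  fixes f :: "'a \<Rightarrow> 'b::comm_semiring_1"
  assumes "finite S"
  shows "(\<Sum>l | set l \<subseteq> S \<and> length l = n. \<Prod>a\<leftarrow>l. f a) = sum f S ^ n"
proof (induction n)
  case 0
  have "{l. set l \<subseteq> S \<and> length l = 0} = {[]}" by auto
  then show ?case by simp
next
  case (Suc n)
  have inj: "inj_on (\<lambda>(xs, n). n # xs) ({l. set l \<subseteq> S \<and> length l = n} \<times> S)" by (auto simp: inj_on_def)
  have "(\<Sum>l | set l \<subseteq> S \<and> length l = Suc n. \<Prod>a\<leftarrow>l. f a)
      = (\<Sum>(l, a)\<in>{l. set l \<subseteq> S \<and> length l = n} \<times> S. f a * (\<Prod>a\<leftarrow>l. f a))"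
    unfolding lists_length_Suc_eq sum.reindex[OF inj] by (intro sum.cong) auto
  also have "\<dots> = (\<Sum>l | set l \<subseteq> S \<and> length l = n. \<Sum>a\<in>S. f a * (\<Prod>a\<leftarrow>l. f a))"
    by (rule sum.cartesian_product[symmetric])
  also have "\<dots> = sum f S ^ Suc n"
    by (simp add: Suc flip: sum_distrib_right sum_distrib_left)
  finally show ?case .
qed

text \<open>
  The cover is indexed by digit strings \<open>l\<close>, restricted to those \<open>x\<close> whose denominator has
  already reached \<open>M ^ length l\<close>. With \<open>(2 + \<beta>) * s = \<eta> + (1 + \<eta>)\<close>, the factor \<open>q powr - \<eta>\<close> gains
  \<open>M powr - \<eta>\<close> for every digit, and \<open>q powr - (1 + \<eta>)\<close> is summable over the strings of one length
  because the denominator dominates the product of the digits.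
\<close>
lemma hausdorff_measure_J_star_zero:
  assumes \<beta>: "\<beta> > 0" and s: "s > 1 / (2 + \<beta>)"
  shows "hausdorff_measure s (J_star \<beta>) = 0"
proof (rule hausdorff_measure_zeroI[where 'i = "nat list"])
  have "0 < 1 / (2 + \<beta>)" using \<beta> by simp
  then show s0: "s > 0" using s by linarith
  fix e :: real assume e: "e > 0"
  define \<eta> where "\<eta> = ((2 + \<beta>) * s - 1) / 2"
  have \<eta>: "\<eta> > 0" and \<tau>: "(2 + \<beta>) * s = \<eta> + (1 + \<eta>)" using s \<beta> by (auto simp: \<eta>_def field_simps)
  define h where "h k = real k powr - (1 + \<eta>)" for k :: nat
  have smh: "summable h" unfolding h_def using \<eta> by (simp add: summable_real_powr_iff)
  have h0: "h k \<ge> 0" for k by (simp add: h_def)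
  define Z where "Z = suminf h + 1"
  have Z: "Z \<ge> 1" using suminf_nonneg[OF smh h0] by (simp add: Z_def)
  \<comment> \<open>Chosen so that each further digit contributes a factor of at most \<open>1/2\<close>.\<close>
  define M where "M = (2 * Z) powr (1 / \<eta>)"
  have M: "M > 1" using Z \<eta> by (simp add: M_def)
  have MZ: "M powr - \<eta> * Z = 1 / 2" using Z \<eta> by (simp add: M_def powr_powr powr_minus_divide)
  have "(\<lambda>N. 2 powr s * (2 * (1/2) ^ N)) \<longlonglongrightarrow> 2 powr s * (2 * 0)"
    by (intro tendsto_intros) auto
  then have "eventually (\<lambda>N. 2 powr s * (2 * (1/2) ^ N) < e) sequentially"
    using e by (intro order_tendstoD(2)) auto
  then obtain N where N: "2 powr s * (2 * (1/2) ^ N) < e" by (auto simp: eventually_sequentially)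
  define digits where "digits x n = map (\<lambda>i. partial_quotient i x) [1..<Suc n]" for x n
  define U where "U l = {x \<in> {0..<1} - \<rat>. N \<le> length l \<and> digits x (length l) = l \<and>
     real (cf_denom (length l) x) powr \<beta> \<le> partial_quotient (Suc (length l)) x \<and>
     M ^ length l \<le> cf_denom (length l) x}" for l
  have bd: "\<forall>l. bounded (U l)"
    by (rule allI, rule bounded_subset[of "{0..1}"]) (auto simp: U_def)
  have sub: "J_star \<beta> \<subseteq> (\<Union>l. U l)"
  proof
    fix x assume xJ: "x \<in> J_star \<beta>"
    then have x: "x \<in> {0..<1} - \<rat>"
      and inf: "infinite {n. 1 \<le> n \<and> real (cf_denom n x) powr \<beta> \<le> partial_quotient (n + 1) x}"
      and lim: "filterlim (\<lambda>n. ln (real (cf_denom n x)) / real n) at_top sequentially"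
      by (auto simp: J_def J_star_def)
    interpret cf_expansion x "\<lambda>i. partial_quotient i x" "\<lambda>n. (gauss_map ^^ n) x"
      by (rule irrational_cf_expansion[OF x])
    have "eventually (\<lambda>n. ln M \<le> ln (real (cf_denom n x)) / real n) sequentially"
      using lim by (simp add: filterlim_at_top)
    then obtain n0 where n0: "\<And>n. n \<ge> n0 \<Longrightarrow> ln M \<le> ln (real (cf_denom n x)) / real n"
      by (auto simp: eventually_sequentially)
    obtain n where n: "n \<ge> max N n0" "1 \<le> n"
        "real (cf_denom n x) powr \<beta> \<le> partial_quotient (Suc n) x"
      using inf[unfolded infinite_nat_iff_unbounded_le, rule_format, of "max N n0"] by auto
    have "real n * ln M \<le> ln (real (cf_denom n x))" using n0[of n] n(1,2) by (simp add: field_simps)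
    then have "exp (real n * ln M) \<le> exp (ln (real (cf_denom n x)))" by simp
    also have "exp (real n * ln M) = M ^ n" using M by (simp add: exp_of_nat_mult)
    also have "exp (ln (real (cf_denom n x))) = cf_denom n x"
      using den_pos[of n] by (simp add: cf_denom_eq_den)
    finally have "M ^ n \<le> cf_denom n x" .
    moreover have "length (digits x n) = n" by (simp add: digits_def del: upt_Suc)
    ultimately have "x \<in> U (digits x n)" using x n by (auto simp: U_def)
    then show "x \<in> (\<Union>l. U l)" by blast
  qed
  define g where "g l = 2 powr s * ((M powr - \<eta>) ^ length l * (\<Prod>k\<leftarrow>l. h k))" for l
  have "(\<Prod>k\<leftarrow>l. h k) \<ge> 0" for l by (induction l) (auto simp: h0)
  then have g0: "g l \<ge> 0" for l by (simp add: g_def)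
  have diamU: "diameter (U l) powr s \<le> g l" for l
  proof (cases "U l = {}")
    case True
    then show ?thesis using g0 by simp
  next
    case False
    then obtain x where x: "x \<in> U l" by blast
    define n where "n = length l"
    define a where "a = (\<lambda>i. partial_quotient i x)"
    define q where "q = den a n"
    interpret cf_expansion x a "\<lambda>n. (gauss_map ^^ n) x"
      unfolding a_def by (rule irrational_cf_expansion) (use x U_def in auto)
    have q: "real q \<ge> 1" using den_pos[of n] by (simp add: q_def)
    have "U l \<subseteq> cball (num a n / q) (real q powr - (2 + \<beta>))"
    proof
      fix y assume y: "y \<in> U l"
      define b where "b = (\<lambda>i. partial_quotient i y)"
      have "digits y n = digits x n" using x y by (simp add: U_def n_def)
      then have "b i = a i" if "1 \<le> i" "i \<le> n" for i
        using that by (auto simp: digits_def b_def a_def map_eq_conv simp del: upt_Suc)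
      then have "num b n = num a n" "den b n = den a n" using convergent_cong[of n b a] by auto
      moreover have "\<bar>y - num b n / den b n\<bar> \<le> real (den b n) powr - (2 + \<beta>)"
        unfolding b_def by (rule convergent_close) (use y in \<open>auto simp: U_def n_def\<close>)
      ultimately show "y \<in> cball (num a n / q) (real q powr - (2 + \<beta>))"
        by (simp add: q_def dist_real_def abs_minus_commute)
    qed
    then have "diameter (U l) \<le> diameter (cball (num a n / q) (real q powr - (2 + \<beta>)))"
      by (intro diameter_subset) auto
    then have "diameter (U l) \<le> 2 * real q powr - (2 + \<beta>)" by (simp add: diameter_cball)
    then have "diameter (U l) powr s \<le> (2 * real q powr - (2 + \<beta>)) powr s"
      using s0 bd by (intro powr_mono2) (auto intro: diameter_ge_0)
    also have "\<dots> = 2 powr s * (real q powr - \<eta> * real q powr - (1 + \<eta>))"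
      unfolding ball_powr \<tau> by (simp flip: powr_add)
    also have "\<dots> \<le> g l"
      unfolding g_def
    proof (intro mult_left_mono mult_mono)
      have Mq: "M ^ n \<le> real q" using x by (simp add: U_def n_def q_def a_def cf_denom_eq_den)
      then have "real q powr - \<eta> \<le> (M ^ n) powr - \<eta>"
        using \<eta> M by (intro powr_mono2') auto
      also have "\<dots> = (M powr - \<eta>) ^ length l"
        using M by (simp add: n_def powr_power powr_realpow[symmetric] powr_powr mult.commute)
      finally show "real q powr - \<eta> \<le> (M powr - \<eta>) ^ length l" .
      have l: "l = map a [1..<Suc n]" using x by (simp add: U_def digits_def a_def n_def del: upt_Suc)
      have apos: "1 \<le> a i" if "1 \<le> i" for i using digit_pos[of "i - 1"] that by simp
      have le: "real (\<Prod>i=1..n. a i) \<le> real q" unfolding q_def of_nat_le_iff by (rule prod_le_den)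
      have "0 < (\<Prod>i=1..n. a i)" using apos by (intro prod_pos) force
      then have pos: "0 < real (\<Prod>i=1..n. a i)" by (simp only: of_nat_0_less_iff)
      have "real q powr - (1 + \<eta>) \<le> real (\<Prod>i=1..n. a i) powr - (1 + \<eta>)"
        by (rule powr_mono2'[OF _ pos le]) (use \<eta> in simp)
      also have "\<dots> = (\<Prod>i=1..n. h (a i))" by (simp add: h_def prod_powr_distrib)
      also have "\<dots> = (\<Prod>k\<leftarrow>l. h k)"
        using prod.distinct_set_conv_list[of "[1..<Suc n]" "\<lambda>i. h (a i)"]
        by (simp add: l comp_def atLeastLessThanSuc_atLeastAtMost del: upt_Suc)
      finally show "real q powr - (1 + \<eta>) \<le> (\<Prod>k\<leftarrow>l. h k)" .
    qed (use M in auto)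
    finally show ?thesis .
  qed
  have "(\<Sum>l\<in>F. diameter (U l) powr s) \<le> e" if F: "finite F" for F
  proof -
    define L where "L = Suc (Max (insert 0 (length ` F)))"
    define B where "B = (\<Union>l\<in>F. set l)"
    have fB: "finite B" using F by (auto simp: B_def)
    define T where "T n = {l. set l \<subseteq> B \<and> length l = n}" for n
    have fT: "finite (T n)" for n unfolding T_def by (rule finite_lists_length_eq[OF fB])
    define G where "G = (\<Union>n\<in>{N..<L}. T n)"
    have fG: "finite G" using fT by (auto simp: G_def)
    have "(\<Sum>l\<in>F. diameter (U l) powr s) = (\<Sum>l\<in>F \<inter> G. diameter (U l) powr s)"
    proof (rule sum.mono_neutral_right)
      have "length l < L" if "l \<in> F" for l
        unfolding L_def less_Suc_eq_le using F that by (intro Max_ge) auto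
      then have "length l < N" if "l \<in> F - G" for l
        using that by (auto simp: G_def T_def B_def not_le[symmetric])
      then have "U l = {}" if "l \<in> F - G" for l using that by (fastforce simp: U_def)
      then show "\<forall>l\<in>F - F \<inter> G. diameter (U l) powr s = 0" by auto
    qed (use F in auto)
    also have "\<dots> \<le> (\<Sum>l\<in>F \<inter> G. g l)" by (intro sum_mono diamU)
    also have "\<dots> \<le> (\<Sum>l\<in>G. g l)" by (rule sum_mono2) (use fG g0 in auto)
    also have "\<dots> = (\<Sum>n=N..<L. \<Sum>l\<in>T n. g l)"
      unfolding G_def by (rule sum.UNION_disjoint) (use fT in \<open>auto simp: T_def\<close>)
    also have "\<dots> \<le> (\<Sum>n=N..<L. 2 powr s * (1/2) ^ n)"
    proof (rule sum_mono)
      fix n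
      have "(\<Sum>l\<in>T n. g l) = (\<Sum>l\<in>T n. 2 powr s * (M powr - \<eta>) ^ n * (\<Prod>k\<leftarrow>l. h k))"
        by (intro sum.cong) (auto simp: T_def g_def)
      also have "\<dots> = 2 powr s * (M powr - \<eta>) ^ n * sum h B ^ n"
        unfolding T_def sum_distrib_left[symmetric] sum_prod_list[OF fB] ..
      also have "\<dots> \<le> 2 powr s * (M powr - \<eta>) ^ n * Z ^ n"
      proof (intro mult_left_mono power_mono)
        show "sum h B \<le> Z" using sum_le_suminf[OF smh fB] h0 by (simp add: Z_def add_increasing2)
      qed (auto simp: h0 sum_nonneg)
      also have "\<dots> = 2 powr s * (1/2) ^ n" by (simp add: MZ[symmetric] power_mult_distrib)
      finally show "(\<Sum>l\<in>T n. g l) \<le> 2 powr s * (1/2) ^ n" .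
    qed
    also have "\<dots> \<le> 2 powr s * (2 * (1/2) ^ N)"
    proof -
      have "(\<Sum>n=N..<L. (1/2::real) ^ n) \<le> 2 * (1/2) ^ N"
      proof (cases "N \<le> L")
        case True
        have "(\<Sum>n=N..<K. (1/2::real) ^ n) = 2 * (1/2) ^ N - 2 * (1/2) ^ K" if "N \<le> K" for K
          using that by (induction K rule: dec_induct) auto
        then show ?thesis using True by simp
      qed simp
      then show ?thesis by (simp add: sum_distrib_left[symmetric])
    qed
    also have "\<dots> \<le> e" using N by simp
    finally show ?thesis .
  qed
  then show "\<exists>U :: nat list \<Rightarrow> real set. (\<forall>i. bounded (U i)) \<and> J_star \<beta> \<subseteq> (\<Union>i. U i) \<and>
      (\<forall>F. finite F \<longrightarrow> (\<Sum>i\<in>F. diameter (U i) powr s) \<le> e)"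
    using bd sub by blast
qed

section \<open>Lower bound for the rapidly growing case\<close>

lemma moebius_step:
  fixes p p' q q' s :: real
  assumes "s > 0"
  shows "(p * s + p') / (q * s + q') = (p + p' * (1 / s)) / (q + q' * (1 / s))"
proof -
  have "p * s + p' = (p + p' * (1 / s)) * s" "q * s + q' = (q + q' * (1 / s)) * s"
    using assms by (simp_all add: field_simps)
  then show ?thesis using assms by simp
qed

text \<open>The recursion gives \<open>q\<^sub>n\<^sub>+\<^sub>1 \<ge> q\<^sub>n\<^sup>1\<^sup>+\<^sup>\<beta>\<close>, so \<open>ln q\<^sub>n\<close> itself grows exponentially.\<close>
lemma ln_den_growth:
  assumes "cf_expansion x a t" and \<beta>: "\<beta> > 0" and a1: "2 \<le> a 1"
    and big: "\<And>n. real (den a n) powr \<beta> \<le> a (Suc n)"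
  shows "filterlim (\<lambda>n. ln (real (den a n)) / real n) at_top sequentially"
proof -
  interpret cf_expansion x a t by fact
  have lower: "(1 + \<beta>) ^ n * ln 2 \<le> ln (real (den a (Suc n)))" for n
  proof (induction n)
    case 0
    show ?case using a1 by simp
  next
    case (Suc n)
    let ?q = "real (den a (Suc n))"
    have q: "?q \<ge> 1" using den_pos[of "Suc n"] by linarith
    have "?q powr (1 + \<beta>) = ?q * ?q powr \<beta>" using q by (simp add: powr_add)
    also have "\<dots> \<le> ?q * a (Suc (Suc n))" using big[of "Suc n"] q by (intro mult_left_mono) simp_all
    also have "\<dots> \<le> real (den a (Suc (Suc n)))"
      by (simp only: den.simps(2)[of a "Suc n"] of_nat_add of_nat_mult) (simp add: mult.commute)
    finally have *: "?q powr (1 + \<beta>) \<le> real (den a (Suc (Suc n)))" .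
    have "(1 + \<beta>) ^ Suc n * ln 2 \<le> (1 + \<beta>) * ln ?q"
      using Suc \<beta> by (simp add: mult.assoc del: den.simps)
    also have "\<dots> = ln (?q powr (1 + \<beta>))" using q by (simp add: ln_powr del: den.simps)
    also have "\<dots> \<le> ln (real (den a (Suc (Suc n))))"
      using * q den_pos[of "Suc (Suc n)"] by (subst ln_le_cancel_iff) (simp_all del: den.simps)
    finally show ?case .
  qed
  have "filterlim (\<lambda>n. (1 + \<beta>) ^ n * ln 2 / real (Suc n)) at_top sequentially"
    using \<beta> by real_asymp
  then have "filterlim (\<lambda>n. ln (real (den a (Suc n))) / real (Suc n)) at_top sequentially"
    by (rule filterlim_at_top_mono) (intro always_eventually allI divide_right_mono lower, simp)
  then show ?thesis by (subst (asm) filterlim_sequentially_Suc)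
qed

text \<open>
  A node \<open>(p, p', q, q', w)\<close> records the last two convergents \<open>p / q\<close> and \<open>p' / q'\<close> of a digit string,
  and its mass \<open>w\<close>; its interval is the closed cylinder, parametrised by the remainder \<open>t\<close>. The next digit
  runs through \<open>L, L + 2, \<dots>, 3 L - 2\<close> with \<open>L\<close> about \<open>q powr \<beta>\<close>; omitting every second digit leaves gaps
  comparable to the cylinders, of size about \<open>1 / (L q)\<^sup>2\<close>. So the children are spread over a length of about
  \<open>1 / (L q\<^sup>2)\<close>, which is about \<open>q powr - (2 + \<beta>)\<close>, and the weight condition becomes the invariant
  \<open>q powr \<sigma> * w \<le> 1\<close> with \<open>\<sigma> = (2 + \<beta>) * s < 1\<close>. One step multiplies \<open>q\<close> by at most \<open>3 L\<close> and
  divides \<open>w\<close> by \<open>L\<close>; since \<open>\<sigma> < 1\<close>, the invariant persists as soon as \<open>L\<close> is large.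
\<close>
lemma hausdorff_measure_J_star_nonzero:
  assumes \<beta>: "\<beta> > 0" and s0: "0 \<le> s" and s1: "s < 1 / (2 + \<beta>)"
  shows "hausdorff_measure s (J_star \<beta>) \<noteq> 0"
proof -
  define \<sigma> where "\<sigma> = (2 + \<beta>) * s"
  have \<sigma>: "0 \<le> \<sigma>" "\<sigma> < 1" using \<beta> s0 s1 by (auto simp: \<sigma>_def field_simps)
  \<comment> \<open>A lower bound for all digits that absorbs the factor 3 in the invariant, see \<open>contract\<close>.\<close>
  define K where "K = nat \<lceil>3 powr (1 / (1 - \<sigma>))\<rceil>"
  have K3: "3 powr (1 / (1 - \<sigma>)) \<le> real K" unfolding K_def by linarith
  have "3 powr 1 \<le> 3 powr (1 / (1 - \<sigma>))" using \<sigma> by (intro powr_mono) (auto simp: field_simps)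
  then have K: "3 \<le> K" using K3 by simp
  define L where "L q = max K (nat \<lceil>real q powr \<beta>\<rceil>)" for q :: nat
  have LK: "K \<le> L q" for q by (simp add: L_def)
  have L3: "3 \<le> L q" for q using LK[of q] K by linarith
  have Lq: "real q powr \<beta> \<le> L q" for q unfolding L_def by linarith
  have Lup: "real (L q) \<le> (real K + 2) * real q powr \<beta>" if "1 \<le> q" for q
  proof -
    have q1: "1 \<le> real q powr \<beta>" using that \<beta> by (intro ge_one_powr_ge_zero) auto
    have "real (nat \<lceil>real q powr \<beta>\<rceil>) \<le> real q powr \<beta> + 1" using q1 by linarith
    then have "real (L q) \<le> real K * 1 + (real q powr \<beta> + 1)"
      unfolding L_def of_nat_max using q1 by linarith
    also have "\<dots> \<le> K * real q powr \<beta> + (real q powr \<beta> + real q powr \<beta>)"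
      using q1 by (intro add_mono mult_left_mono) auto
    finally show ?thesis by (simp add: algebra_simps)
  qed
  have contract: "(3 * real (L q)) powr \<sigma> / L q \<le> 1" for q
  proof -
    have L0: "real (L q) > 0" using L3[of q] by simp
    have "3 = (3 powr (1 / (1 - \<sigma>))) powr (1 - \<sigma>)" using \<sigma> by (simp add: powr_powr)
    also have "\<dots> \<le> real (L q) powr (1 - \<sigma>)"
      using K3 LK[of q] \<sigma> by (intro powr_mono2) auto
    finally have "3 * real (L q) powr \<sigma> \<le> real (L q) powr (1 - \<sigma>) * real (L q) powr \<sigma>"
      by (intro mult_right_mono) auto
    then have *: "3 * real (L q) powr \<sigma> \<le> L q" using L0 by (simp flip: powr_add)
    have "3 powr \<sigma> \<le> (3::real) powr 1" using \<sigma> by (intro powr_mono) auto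
    then have "(3 * real (L q)) powr \<sigma> \<le> 3 * real (L q) powr \<sigma>"
      by (simp add: powr_mult mult_right_mono)
    with * L0 show ?thesis by simp
  qed

  define M where "M = (\<lambda>(p::nat, p'::nat, q::nat, q'::nat, w::real) (t::real). (p + p' * t) / (q + q' * t))"
  define I where "I v = M v ` {0..1}" for v
  define G where "G = (\<lambda>(p::nat, p'::nat, q::nat, q'::nat, w::real). 1 \<le> q \<and> q' \<le> q \<and>
    \<bar>real p * q' - real p' * q\<bar> = 1 \<and> 0 < w \<and> real q powr \<sigma> * w \<le> 1)"
  define child where "child = (\<lambda>(p::nat, p'::nat, q::nat, q'::nat, w::real) (j::nat).
    ((L q + 2 * j) * p + p', p, (L q + 2 * j) * q + q', q, w / L q))"
  define m where "m = (\<lambda>(p::nat, p'::nat, q::nat, q'::nat, w::real). L q)"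
  define W where "W = (\<lambda>(p::nat, p'::nat, q::nat, q'::nat, w::real). w)"
  define gap where "gap = (\<lambda>(p::nat, p'::nat, q::nat, q'::nat, w::real). 1 / (36 * (real (L q))\<^sup>2 * (real q)\<^sup>2))"
  define ch where "ch v = child v ` {..<m v}" for v
  define r :: "nat \<times> nat \<times> nat \<times> nat \<times> real" where "r = (0, 1, 1, 0, 1)"

  have inj: "inj_on (child v) {..<m v}" if "G v" for v
    using that by (cases v) (auto simp: inj_on_def child_def G_def)
  have card_ch: "card (ch v) = m v" if "G v" for v
    unfolding ch_def using card_image[OF inj[OF that]] by simp
  have M_child: "M (child v j) t = M v (1 / (real (m v + 2 * j) + t)) \<and>
      0 < 1 / (real (m v + 2 * j) + t) \<and> 1 / (real (m v + 2 * j) + t) \<le> 1" if "0 \<le> t" for v j t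
  proof -
    obtain p p' q q' w where v: "v = (p, p', q, q', w)" by (cases v)
    have pos: "1 \<le> real (m v + 2 * j) + t" using L3[of q] that by (simp add: v m_def)
    have "M (child v j) t = (p * (real (m v + 2 * j) + t) + p') / (q * (real (m v + 2 * j) + t) + q')"
      by (simp add: M_def child_def m_def v algebra_simps)
    also have "\<dots> = M v (1 / (real (m v + 2 * j) + t))"
      using pos by (subst moebius_step) (auto simp: M_def v)
    finally show ?thesis using pos by simp
  qed
  have M_diff: "\<bar>M v t - M v u\<bar> = \<bar>t - u\<bar> / \<bar>(real q + q' * t) * (real q + q' * u)\<bar>"
    if "G v" "v = (p, p', q, q', w)" "0 \<le> t" "0 \<le> u" for v and p p' q q' :: nat and w t u :: real
  proof -
    have "real q + q' * t > 0" "real q + q' * u > 0"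
      using that by (auto simp: G_def intro!: add_pos_nonneg)
    moreover have "\<bar>real p' * q - real p * q'\<bar> = 1" using that by (simp add: G_def abs_minus_commute)
    ultimately show ?thesis
      by (simp add: that(2) M_def moebius_diff abs_mult abs_divide)
  qed

  show ?thesis
  proof (rule separated_tree_hausdorff_measure_nonzero[where G = G and r = r and I = I and ch = ch
        and W = W and gap = gap and C = "(36 * (real K + 2)) powr s"])
    show "G r" "W r > 0" by (auto simp: G_def W_def r_def)
    show "(36 * (real K + 2)) powr s > 0" by simp
    show "0 \<le> s" by (rule s0)
    have "1 / (2 + \<beta>) \<le> 1" using \<beta> by simp
    then show "s \<le> 1" using s1 by linarith
  next
    fix v assume G: "G v"
    obtain p p' q q' w where v: "v = (p, p', q, q', w)" by (cases v)
    have "continuous_on {0..1} (M v)"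
      unfolding v M_def prod.case
    proof (intro continuous_intros ballI)
      fix t :: real assume "t \<in> {0..1}"
      then have "real q + q' * t > 0" using G by (auto simp: v G_def intro!: add_pos_nonneg)
      then show "real q + q' * t \<noteq> 0" by simp
    qed
    then show "compact (I v) \<and> I v \<noteq> {}" unfolding I_def by (auto intro: compact_continuous_image)
    show "finite (ch v) \<and> 2 \<le> card (ch v)"
      using L3[of q] by (simp add: card_ch[OF G]) (simp add: ch_def v m_def)
    show "gap v > 0" using G L3[of q] by (auto simp: gap_def v G_def)
    show "W v \<le> (36 * (real K + 2)) powr s * (gap v * card (ch v)) powr s"
    proof -
      have q: "1 \<le> q" using G by (simp add: v G_def)
      have L0: "real (L q) > 0" using L3[of q] by simp
      have "gap v * card (ch v) = 1 / (36 * L q * (real q)\<^sup>2)"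
        unfolding card_ch[OF G] using L0 by (simp add: gap_def v m_def power2_eq_square)
      moreover have "36 * L q * (real q)\<^sup>2 \<le> 36 * ((real K + 2) * real q powr \<beta>) * (real q)\<^sup>2"
        using Lup[OF q] by (intro mult_right_mono mult_left_mono) auto
      moreover have "36 * ((real K + 2) * real q powr \<beta>) * (real q)\<^sup>2 = 36 * (real K + 2) * real q powr (2 + \<beta>)"
        using q by (simp add: powr_add powr_numeral)
      ultimately have gm: "1 / (36 * (real K + 2) * real q powr (2 + \<beta>)) \<le> gap v * card (ch v)"
        using L0 q by (auto intro!: divide_left_mono mult_pos_pos)
      have "w \<le> 1 / real q powr \<sigma>" using G q by (simp add: v G_def field_simps)
      also have "\<dots> = (36 * (real K + 2)) powr s * (1 / (36 * (real K + 2) * real q powr (2 + \<beta>))) powr s"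
        using q K by (subst powr_mult[symmetric]) (auto simp: \<sigma>_def powr_divide powr_powr)
      also have "\<dots> \<le> (36 * (real K + 2)) powr s * (gap v * card (ch v)) powr s"
        using gm s0 q by (intro mult_left_mono powr_mono2) auto
      finally show ?thesis by (simp add: W_def v)
    qed
  next
    fix v c assume G: "G v" and c: "c \<in> ch v"
    obtain p p' q q' w where v: "v = (p, p', q, q', w)" by (cases v)
    obtain j where j: "j < L q" "c = child v j" using c by (auto simp: ch_def v m_def)
    define a where "a = L q + 2 * j"
    have q: "1 \<le> q" "q' \<le> q" and w: "0 < w" "real q powr \<sigma> * w \<le> 1"
      and det: "\<bar>real p * q' - real p' * q\<bar> = 1" using G by (auto simp: v G_def)
    have L0: "real (L q) > 0" using L3[of q] by simp
    have c_eq: "c = (a * p + p', p, a * q + q', q, w / L q)" by (simp add: j child_def v a_def)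
    have a1: "1 \<le> a" "a + 1 \<le> 3 * L q" using L3[of q] j by (auto simp: a_def)
    have qc: "q \<le> a * q + q'" using a1 by (simp add: trans_le_add1)
    have "a * q + q' \<le> (a + 1) * q" using q by simp
    also have "\<dots> \<le> 3 * L q * q" using a1 by (intro mult_right_mono) auto
    finally have "a * q + q' \<le> 3 * L q * q" .
    then have "real (a * q + q') \<le> real (3 * L q * q)" by (simp only: of_nat_le_iff)
    then have "real (a * q + q') powr \<sigma> \<le> (3 * L q * real q) powr \<sigma>"
      using \<sigma> by (intro powr_mono2) auto
    also have "\<dots> = (3 * real (L q)) powr \<sigma> * real q powr \<sigma>" by (simp add: powr_mult)
    finally have "real (a * q + q') powr \<sigma> * (w / L q) \<le> (3 * real (L q)) powr \<sigma> * real q powr \<sigma> * (w / L q)"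
      using w by (intro mult_right_mono) auto
    also have "\<dots> = ((3 * real (L q)) powr \<sigma> / L q) * (real q powr \<sigma> * w)" by simp
    also have "\<dots> \<le> 1 * 1" using contract w by (intro mult_mono) auto
    finally have wc: "real (a * q + q') powr \<sigma> * (w / L q) \<le> 1" by simp
    have "real (a * p + p') * q - real p * real (a * q + q') = - (real p * q' - real p' * q)"
      by (simp add: algebra_simps)
    then have "\<bar>real (a * p + p') * q - real p * real (a * q + q')\<bar> = 1" using det by simp
    then have "G c" using qc q w L0 wc unfolding c_eq G_def by auto
    moreover have "I c \<subseteq> I v"
    proof
      fix x assume "x \<in> I c"
      then obtain t where t: "0 \<le> t" "t \<le> 1" "x = M (child v j) t" by (auto simp: I_def j)
      then show "x \<in> I v" using M_child[of t v j] by (auto simp: I_def intro!: image_eqI)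
    qed
    moreover have "W c = W v / card (ch v)" 
      unfolding card_ch[OF G] by (simp add: c_eq W_def v m_def)
    ultimately show "G c \<and> I c \<subseteq> I v \<and> W c = W v / card (ch v)" by blast
  next
    fix v b c x y
    assume G: "G v" and bc: "b \<in> ch v" "c \<in> ch v" "b \<noteq> c" and x: "x \<in> I b" and y: "y \<in> I c"
    obtain p p' q q' w where v: "v = (p, p', q, q', w)" by (cases v)
    have q: "1 \<le> q" "q' \<le> q" using G by (auto simp: v G_def)
    obtain i j where ij: "i < L q" "j < L q" "b = child v i" "c = child v j" "i \<noteq> j"
      using bc by (auto simp: ch_def v m_def)
    obtain t u where t: "0 \<le> t" "t \<le> 1" "x = M (child v i) t" and u: "0 \<le> u" "u \<le> 1" "y = M (child v j) u"
      using x y by (auto simp: I_def ij)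
    define A B where "A = real (L q + 2 * i) + t" and "B = real (L q + 2 * j) + u"
    have xy: "x = M v (1 / A)" "y = M v (1 / B)"
      and A: "0 < 1 / A" "1 / A \<le> 1" and B: "0 < 1 / B" "1 / B \<le> 1"
      using M_child[of t v i] M_child[of u v j] t u by (auto simp: A_def B_def v m_def)
    have A0: "0 < A" "0 < B" using A B by simp_all
    have A3: "A \<le> 3 * L q" "B \<le> 3 * L q" using ij t u by (auto simp: A_def B_def)
    have AB: "1 \<le> \<bar>B - A\<bar>" using ij(5) t u by (auto simp: A_def B_def)
    have "1 / (9 * (real (L q))\<^sup>2) = 1 / (3 * real (L q) * (3 * real (L q)))" by (simp add: power2_eq_square)
    also have "\<dots> \<le> 1 / (A * B)"
    proof (rule divide_left_mono)
      show "A * B \<le> 3 * real (L q) * (3 * real (L q))" using A0 A3 by (intro mult_mono) auto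
      show "0 < 3 * real (L q) * (3 * real (L q)) * (A * B)" using A0 L3[of q] by simp
    qed simp
    also have "\<dots> \<le> \<bar>B - A\<bar> / (A * B)" using AB A0 by (intro divide_right_mono) auto
    also have "\<dots> = \<bar>1 / A - 1 / B\<bar>"
      using A0 by (simp add: diff_frac_eq abs_divide abs_mult)
    finally have num: "1 / (9 * (real (L q))\<^sup>2) \<le> \<bar>1 / A - 1 / B\<bar>" .
    have d: "0 < real q + q' * z \<and> real q + q' * z \<le> 2 * q" if z: "0 < z" "z \<le> 1" for z :: real
    proof -
      have "real q' * z \<le> real q * 1" using z q by (intro mult_mono) auto
      moreover have "0 \<le> real q' * z" using z by simp
      ultimately show ?thesis using q by auto
    qed
    have "gap v = (1 / (9 * (real (L q))\<^sup>2)) / (2 * real q * (2 * real q))"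
      by (simp add: gap_def v power2_eq_square)
    also have "\<dots> \<le> \<bar>1 / A - 1 / B\<bar> / ((real q + q' * (1 / A)) * (real q + q' * (1 / B)))"
      using num d[OF A] d[OF B] by (intro frac_le mult_mono mult_pos_pos) auto
    also have "\<dots> = \<bar>x - y\<bar>"
      using M_diff[OF G v, of "1 / A" "1 / B"] A B d[OF A] d[OF B] by (simp add: xy abs_mult)
    finally show "gap v \<le> \<bar>x - y\<bar>" .
  next
    fix v x
    assume v0: "v 0 = r" and G: "\<And>k. G (v k)" and chain: "\<And>k. v (Suc k) \<in> ch (v k)"
      and x: "\<And>k. x \<in> I (v k)"
    have "\<forall>k. \<exists>j. v (Suc k) = child (v k) j" using chain by (auto simp: ch_def)
    then obtain j where j: "\<And>k. v (Suc k) = child (v k) (j k)" by metis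
    define a where "a n = m (v (n - 1)) + 2 * j (n - 1)" for n
    have v_eq: "\<exists>w. v k = (num a k, num_prev a k, den a k, den_prev a k, w)" for k
    proof (induction k)
      case 0 then show ?case by (simp add: v0 r_def)
    next
      case (Suc k)
      then obtain w where w: "v k = (num a k, num_prev a k, den a k, den_prev a k, w)" by blast
      have "a (Suc k) = L (den a k) + 2 * j k" by (simp add: a_def w m_def)
      then show ?case unfolding j by (simp add: w child_def)
    qed
    have mv: "m (v k) = L (den a k)" for k using v_eq[of k] by (auto simp: m_def)
    have a_ge: "L (den a k) \<le> a (Suc k)" for k by (simp add: a_def mv)
    have "\<exists>t. 0 \<le> t \<and> t \<le> 1 \<and> x = M (v k) t" for k using x[of k] by (auto simp: I_def)
    then obtain t where t: "\<And>k. 0 \<le> t k" "\<And>k. t k \<le> 1" "\<And>k. x = M (v k) (t k)" by metis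
    have t_Suc: "t k = 1 / (real (a (Suc k)) + t (Suc k))" for k
    proof -
      define u where "u = 1 / (real (a (Suc k)) + t (Suc k))"
      have u: "x = M (v k) u" "0 < u"
        using M_child[OF t(1)[of "Suc k"], of "v k" "j k"] t(3)[of "Suc k"] by (auto simp: u_def j a_def)
      obtain p p' q q' w where vk: "v k = (p, p', q, q', w)" by (cases "v k")
      have "real q + q' * t k > 0" "real q + q' * u > 0"
        using G[of k] t u by (auto simp: G_def vk intro!: add_pos_nonneg)
      then have "\<bar>t k - u\<bar> = 0"
        using M_diff[OF G vk t(1) less_imp_le[OF u(2)], of k] t(3)[of k] u(1) by simp
      then show ?thesis by (simp add: u_def)
    qed
    have cf: "cf_expansion x a t"
    proof
      show "t 0 = x" using t(3)[of 0] by (simp add: v0 r_def M_def)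
      fix n
      have a3: "3 \<le> real (a (Suc n))" using a_ge[of n] L3[of "den a n"] by linarith
      show "0 < t n" "t n < 1" "1 \<le> a (Suc n)" using t_Suc[of n] t(1)[of "Suc n"] a3 by auto
      show "t n = 1 / (real (a (Suc n)) + t (Suc n))" by (rule t_Suc)
    qed
    interpret cf_expansion x a t by (rule cf)
    have big: "real (den a n) powr \<beta> \<le> a (Suc n)" for n
      using Lq[of "den a n"] a_ge[of n] by linarith
    have "{n. 1 \<le> n \<and> real (cf_denom n x) powr \<beta> \<le> partial_quotient (n + 1) x} = {1..}"
      using big by (auto simp: cf_denom_eq partial_quotient_eq)
    then have "x \<in> J \<beta>" using irrational by (simp add: J_def infinite_Ici)
    moreover have "2 \<le> a 1" using a_ge[of 0] L3[of "den a 0"] by simp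
    ultimately show "x \<in> J_star \<beta>"
      using ln_den_growth[OF cf \<beta> _ big] by (simp add: J_star_def cf_denom_eq)
  qed
qed

section \<open>Counting fractions in short intervals\<close>

lemma card_int_interval:
  fixes u v :: real
  assumes "u \<le> v"
  shows "finite {p::int. u \<le> p \<and> p \<le> v}"
    and "v - u - 1 \<le> real (card {p::int. u \<le> p \<and> p \<le> v})"
    and "real (card {p::int. u \<le> p \<and> p \<le> v}) \<le> v - u + 1"
proof -
  have eq: "{p::int. u \<le> p \<and> p \<le> v} = {\<lceil>u\<rceil>..\<lfloor>v\<rfloor>}" by (auto simp: ceiling_le_iff le_floor_iff)
  show "finite {p::int. u \<le> p \<and> p \<le> v}" unfolding eq by simp
  have c: "card {p::int. u \<le> p \<and> p \<le> v} = nat (\<lfloor>v\<rfloor> - \<lceil>u\<rceil> + 1)" unfolding eq by simp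
  have "0 \<le> \<lfloor>v\<rfloor> - \<lceil>u\<rceil> + 1" using assms by linarith
  then have "real (card {p::int. u \<le> p \<and> p \<le> v}) = \<lfloor>v\<rfloor> - \<lceil>u\<rceil> + 1" unfolding c by simp
  then show "v - u - 1 \<le> real (card {p::int. u \<le> p \<and> p \<le> v})"
    "real (card {p::int. u \<le> p \<and> p \<le> v}) \<le> v - u + 1" by linarith+
qed

lemma sum_inverse_squares_le: "(\<Sum>d=2..n. 1 / (real d)\<^sup>2) \<le> 3 / 4"
proof (cases "2 \<le> n")
  case True
  then have "(\<Sum>d=2..n. 1 / (real d)\<^sup>2) \<le> 3 / 4 - 1 / real n"
  proof (induction n rule: dec_induct)
    case base
    show ?case by simp
  next
    case (step n)
    have "1 / (real (Suc n))\<^sup>2 \<le> 1 / (real n * real (Suc n))"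
      using step by (intro divide_left_mono) (auto simp: power2_eq_square)
    also have "\<dots> = 1 / real n - 1 / real (Suc n)" using step by (simp add: field_simps)
    finally show ?case using step by simp
  qed
  then show ?thesis by (rule order_trans) simp
qed simp

lemma sum_inverse_le: "(\<Sum>d=2..n. 1 / real d) \<le> 2 * sqrt n"
proof (cases "1 \<le> n")
  case True
  then show ?thesis
  proof (induction n rule: dec_induct)
    case base
    show ?case by simp
  next
    case (step n)
    define u v where "u = sqrt n" and "v = sqrt (Suc n)"
    have uv: "0 \<le> u" "u \<le> v" "0 < v" "v * v = u * u + 1" by (auto simp: u_def v_def)
    have "(v - u) * (v + u) = 1" using uv by (simp add: algebra_simps)
    moreover have "(v - u) * (v + u) \<le> (v - u) * (2 * v)" using uv by (intro mult_left_mono) auto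
    moreover have "1 \<le> v" using uv by (simp add: v_def)
    ultimately have "1 / v \<le> 2 * (v - u)" and v1: "1 \<le> v"
      using uv by (simp_all add: pos_divide_le_eq mult.commute mult.left_commute)
    moreover have "1 / (v * v) \<le> 1 / v"
      using uv v1 mult_left_mono[OF v1, of v] by (intro divide_left_mono) auto
    ultimately have "1 / (v * v) \<le> 2 * (v - u)" by linarith
    moreover have "v * v = real (Suc n)" by (simp add: v_def)
    ultimately have "1 / real (Suc n) \<le> 2 * v - 2 * u" by simp
    then show ?case using step by (simp add: u_def v_def)
  qed
qed simp

lemma coprime_fraction_eq:
  fixes p q p' q' :: int
  assumes "coprime p q" "coprime p' q'" "0 < q" "0 < q'" "real_of_int p / q = real_of_int p' / q'"
  shows "p = p' \<and> q = q'"
proof -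
  have "real_of_int (p * q') = real_of_int (p' * q)" using assms by (simp add: field_simps)
  then have eq: "p * q' = p' * q" by (simp only: of_int_eq_iff)
  have "q dvd p * q'" "q' dvd p' * q" using eq by (metis dvd_triv_right)+
  then have "q dvd q'" "q' dvd q"
    using assms by (metis coprime_commute coprime_dvd_mult_right_iff)+
  then have "q = q'" using assms zdvd_antisym_nonneg[of q q'] by simp
  then show ?thesis using eq assms by simp
qed

text \<open>
  Any two of these fractions differ by at least \<open>1 / (5 N)\<^sup>2\<close>. Taking them reduced guarantees that
  a fraction cannot recur at infinitely many scales. The window from \<open>4 N\<close> to \<open>5 N\<close> is narrow enough for
  the crude count in \<open>fracs_bounds\<close> to leave a positive proportion.
\<close>
definition fracs :: "nat \<Rightarrow> real \<Rightarrow> real \<Rightarrow> real set" where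
  "fracs N a b = {y \<in> {a..b}. \<exists>p q :: int. coprime p q \<and> 4 * int N < q \<and> q \<le> 5 * int N \<and> y = p / q}"

text \<open>
  All pairs \<open>(q, p)\<close> with \<open>p / q\<close> in the interval are counted, at least about \<open>4 N\<^sup>2 len\<close>, and the non-reduced
  ones are removed according to their greatest common divisor \<open>d\<close>. There are at most
  \<open>(N / d + 1) * (5 N len / d + 1)\<close> of these for each \<open>d \<ge> 2\<close>, and since \<open>\<Sum>d\<ge>2. 1 / d\<^sup>2\<close> is at most
  \<open>3 / 4\<close>, at most about \<open>15 / 4 * N\<^sup>2 len\<close> in total. The crude bound \<open>2 * sqrt n\<close> for the
  harmonic sum is good enough for the lower-order terms.
\<close>
lemma fracs_bounds:
  fixes a len :: real
  assumes l: "len > 0"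
  shows "finite (fracs N a (a + len))"
    and "real N * (4 * real N * len - 1) - (15 / 4 * (real N)\<^sup>2 * len + (real N + 5 * real N * len) * (2 * sqrt (5 * real N)) + 5 * real N)
      \<le> card (fracs N a (a + len))"
proof -
  define P where "P q = {p::int. a * q \<le> p \<and> p \<le> (a + len) * q}" for q :: int
  define All where "All = Sigma {4 * int N<..5 * int N} P"
  define Good where "Good = {(q, p) \<in> All. coprime p q}"
  have Pb: "finite (P q)" "len * q - 1 \<le> card (P q)" "card (P q) \<le> len * q + 1" if "0 \<le> q" for q
  proof -
    have le: "a * q \<le> (a + len) * q" using l that by (intro mult_right_mono) auto
    show "finite (P q)" "len * q - 1 \<le> card (P q)" "card (P q) \<le> len * q + 1"
      unfolding P_def using card_int_interval[OF le] by (auto simp: algebra_simps)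
  qed
  have fAll: "finite All" unfolding All_def using Pb by (intro finite_SigmaI) auto
  then have fGood: "finite Good" by (rule rev_finite_subset) (auto simp: Good_def)
  have img: "fracs N a (a + len) = (\<lambda>(q, p). real_of_int p / q) ` Good"
  proof (intro set_eqI iffI)
    fix y assume "y \<in> fracs N a (a + len)"
    then obtain p q :: int where pq: "a \<le> y" "y \<le> a + len" "coprime p q" "4 * int N < q" "q \<le> 5 * int N" "y = p / q"
      by (auto simp: fracs_def)
    have q: "real_of_int q > 0" using pq by linarith
    have "p \<in> P q" using pq q by (simp add: P_def field_simps)
    then have "(q, p) \<in> Good" using pq by (simp add: Good_def All_def)
    then show "y \<in> (\<lambda>(q, p). real_of_int p / q) ` Good" using pq by force
  next
    fix y assume "y \<in> (\<lambda>(q, p). real_of_int p / q) ` Good"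
    then obtain p q where pq: "coprime p q" "4 * int N < q" "q \<le> 5 * int N" "p \<in> P q" "y = real_of_int p / q"
      by (auto simp: Good_def All_def)
    have q: "real_of_int q > 0" using pq by linarith
    have "y * q = p" using pq(5) q by simp
    then have "a * q \<le> y * q" "y * q \<le> (a + len) * q" using pq(4) by (auto simp: P_def)
    then have "a \<le> y" "y \<le> a + len" using q mult_right_le_imp_le by blast+
    then show "y \<in> fracs N a (a + len)"
      unfolding fracs_def using pq by (intro CollectI conjI exI[of _ p] exI[of _ q]) auto
  qed
  have inj: "inj_on (\<lambda>(q, p). real_of_int p / q) Good"
  proof (rule inj_onI, clarify)
    fix q p q' p'
    assume *: "(q, p) \<in> Good" "(q', p') \<in> Good" "real_of_int p / q = real_of_int p' / q'"
    then have "0 < q" "0 < q'" "coprime p q" "coprime p' q'" by (auto simp: Good_def All_def)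
    then show "q = q' \<and> p = p'" using coprime_fraction_eq *(3) by blast
  qed
  show "finite (fracs N a (a + len))" unfolding img using fGood by simp
  have card_eq: "card (fracs N a (a + len)) = card Good" unfolding img by (rule card_image[OF inj])

  have "real N * (4 * real N * len - 1) = (\<Sum>q\<in>{4 * int N<..5 * int N}. 4 * real N * len - 1)" by simp
  also have "\<dots> \<le> (\<Sum>q\<in>{4 * int N<..5 * int N}. real (card (P q)))"
  proof (rule sum_mono)
    fix q assume q: "q \<in> {4 * int N<..5 * int N}"
    then have "real (4 * N) \<le> real_of_int q" by simp
    then have "real (4 * N) * len \<le> q * len" using l by (intro mult_right_mono) auto
    then show "4 * real N * len - 1 \<le> real (card (P q))" using Pb(2)[of q] q by (simp add: mult.commute)
  qed
  also have "\<dots> = card All" unfolding All_def using Pb by (subst card_SigmaI) auto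
  finally have cAll: "real N * (4 * real N * len - 1) \<le> card All" .

  define Q where "Q d = {q::int. 4 * real N / d \<le> q \<and> q \<le> 5 * real N / d}" for d :: nat
  define B where "B d = Sigma (Q d) P" for d
  have Qpos: "0 \<le> q" if "q \<in> Q d" for q d
  proof -
    have "0 \<le> 4 * real N / d" by simp
    then show ?thesis using that unfolding Q_def by (simp add: order_trans)
  qed
  have le: "4 * real N / d \<le> 5 * real N / d" for d :: nat by (intro divide_right_mono) auto
  have Qb: "finite (Q d)" "card (Q d) \<le> real N / d + 1" for d
    using card_int_interval[OF le[of d]] by (auto simp: Q_def diff_divide_distrib[symmetric])
  have Bb: "finite (B d)" "card (B d) \<le> (real N / d + 1) * (5 * real N * len / d + 1)" for d
  proof -
    show "finite (B d)" unfolding B_def using Qb Pb Qpos by (intro finite_SigmaI) auto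
    have "real (card (B d)) = (\<Sum>q\<in>Q d. real (card (P q)))"
      unfolding B_def using Qb Pb Qpos by (subst card_SigmaI) auto
    also have "\<dots> \<le> (\<Sum>q\<in>Q d. 5 * real N * len / d + 1)"
    proof (rule sum_mono)
      fix q assume q: "q \<in> Q d"
      then have "len * real_of_int q \<le> len * (5 * real N / d)" using l by (intro mult_left_mono) (auto simp: Q_def)
      then show "real (card (P q)) \<le> 5 * real N * len / d + 1"
        using Pb(3)[OF Qpos[OF q]] by (simp add: mult.commute mult.left_commute)
    qed
    also have "\<dots> = card (Q d) * (5 * real N * len / d + 1)" by simp
    also have "\<dots> \<le> (real N / d + 1) * (5 * real N * len / d + 1)"
      using Qb l by (intro mult_right_mono) auto
    finally show "card (B d) \<le> (real N / d + 1) * (5 * real N * len / d + 1)" .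
  qed
  have "All - Good \<subseteq> (\<Union>d\<in>{2..5 * N}. (\<lambda>(q, p). (int d * q, int d * p)) ` B d)"
  proof
    fix z assume "z \<in> All - Good"
    moreover obtain q p where z: "z = (q, p)" by (cases z)
    ultimately have mem: "(q, p) \<in> All" "(q, p) \<notin> Good" by auto
    have q: "4 * int N < q" "q \<le> 5 * int N" and p: "p \<in> P q" using mem(1) by (auto simp: All_def)
    have nc: "\<not> coprime p q" using mem by (simp add: Good_def)
    define d where "d = nat (gcd p q)"
    have dint: "int d = gcd p q" by (simp add: d_def)
    have "q > 0" using q by linarith
    then have gpos: "gcd p q > 0" by simp
    moreover have "gcd p q \<noteq> 1" using nc by (simp add: coprime_iff_gcd_eq_1)
    ultimately have d2: "2 \<le> d" using dint by linarith
    have "gcd p q \<le> q" using \<open>q > 0\<close> by (intro zdvd_imp_le) auto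
    then have d5: "d \<le> 5 * N" using q dint by linarith
    obtain q' p' where q': "q = int d * q'" and p': "p = int d * p'"
      unfolding dint using gcd_dvd1 gcd_dvd2 by (metis dvdE)
    have d0: "real d > 0" using d2 by simp
    have "4 * int N \<le> int d * q'" "int d * q' \<le> 5 * int N" using q q' by auto
    then have "real_of_int (4 * int N) \<le> real_of_int (int d * q')" "real_of_int (int d * q') \<le> real_of_int (5 * int N)"
      by (simp_all only: of_int_le_iff)
    then have "q' \<in> Q d" using d0 by (simp add: Q_def field_simps)
    moreover have "p' \<in> P q'"
    proof -
      have "d * (a * q') \<le> d * p'" "d * real_of_int p' \<le> d * ((a + len) * q')"
        using p by (auto simp: P_def q' p' algebra_simps)
      then show ?thesis using d0 by (simp add: P_def)
    qed
    ultimately have "(q', p') \<in> B d" by (simp add: B_def)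
    then have "z \<in> (\<lambda>(q, p). (int d * q, int d * p)) ` B d" using q' p' z by force
    then show "z \<in> (\<Union>d\<in>{2..5 * N}. (\<lambda>(q, p). (int d * q, int d * p)) ` B d)" using d2 d5 by force
  qed
  then have "card (All - Good) \<le> card (\<Union>d\<in>{2..5 * N}. (\<lambda>(q, p). (int d * q, int d * p)) ` B d)"
    using Bb by (intro card_mono) auto
  also have "\<dots> \<le> (\<Sum>d\<in>{2..5 * N}. card ((\<lambda>(q, p). (int d * q, int d * p)) ` B d))"
    by (intro card_UN_le) auto
  also have "\<dots> \<le> (\<Sum>d\<in>{2..5 * N}. card (B d))"
    by (intro sum_mono card_image_le Bb)
  finally have "real (card (All - Good)) \<le> (\<Sum>d\<in>{2..5 * N}. real (card (B d)))"
    by (metis of_nat_le_iff of_nat_sum)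
  also have "\<dots> \<le> (\<Sum>d\<in>{2..5 * N}. (real N / d + 1) * (5 * real N * len / d + 1))"
    by (intro sum_mono Bb)
  also have "\<dots> = (\<Sum>d\<in>{2..5 * N}. 5 * (real N)\<^sup>2 * len * (1 / (real d)\<^sup>2) + (real N + 5 * real N * len) * (1 / d) + 1)"
    by (intro sum.cong) (auto simp: field_simps power2_eq_square)
  also have "\<dots> = 5 * (real N)\<^sup>2 * len * (\<Sum>d=2..5 * N. 1 / (real d)\<^sup>2)
      + (real N + 5 * real N * len) * (\<Sum>d=2..5 * N. 1 / real d) + card {2..5 * N}"
    by (simp only: sum.distrib sum_distrib_left[symmetric]) simp
  also have "\<dots> \<le> 5 * (real N)\<^sup>2 * len * (3 / 4) + (real N + 5 * real N * len) * (2 * sqrt (5 * real N)) + 5 * real N"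
  proof (intro add_mono mult_left_mono)
    show "(\<Sum>d=2..5 * N. 1 / real d) \<le> 2 * sqrt (5 * real N)" using sum_inverse_le[of "5 * N"] by simp
    have "card {2..5 * N} \<le> 5 * N" by simp
    then have "real (card {2..5 * N}) \<le> real (5 * N)" by (simp only: of_nat_le_iff)
    then show "real (card {2..5 * N}) \<le> 5 * real N" by simp
  qed (use l sum_inverse_squares_le in simp_all)
  finally have "real (card (All - Good)) \<le> 5 * (real N)\<^sup>2 * len * (3 / 4)
      + (real N + 5 * real N * len) * (2 * sqrt (5 * real N)) + 5 * real N" .
  moreover have "real (card (All - Good)) = real (card All) - card Good"
  proof -
    have sub: "Good \<subseteq> All" by (auto simp: Good_def)
    show ?thesis using card_Diff_subset[OF fGood sub] card_mono[OF fAll sub] by (simp add: of_nat_diff)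
  qed
  ultimately show "real N * (4 * real N * len - 1) - (15 / 4 * (real N)\<^sup>2 * len + (real N + 5 * real N * len) * (2 * sqrt (5 * real N)) + 5 * real N)
      \<le> card (fracs N a (a + len))"
    using cAll card_eq by linarith
qed

lemma fracs_card_eventually:
  assumes l: "len > 0"
  shows "eventually (\<lambda>N. \<forall>a. len * (real N)\<^sup>2 / 8 \<le> card (fracs N a (a + len))) sequentially"
proof -
  have "eventually (\<lambda>N. len * (real N)\<^sup>2 / 8 \<le>
      real N * (4 * real N * len - 1) - (15 / 4 * (real N)\<^sup>2 * len + (real N + 5 * real N * len) * (2 * sqrt (5 * real N)) + 5 * real N)) sequentially"
    using l by real_asymp
  then show ?thesis
  proof (rule eventually_mono, intro allI)
    fix N a
    assume "len * (real N)\<^sup>2 / 8 \<le>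
      real N * (4 * real N * len - 1) - (15 / 4 * (real N)\<^sup>2 * len + (real N + 5 * real N * len) * (2 * sqrt (5 * real N)) + 5 * real N)"
    then show "len * (real N)\<^sup>2 / 8 \<le> card (fracs N a (a + len))"
      using fracs_bounds(2)[OF l] by (rule order_trans)
  qed
qed

lemma fraction_separation:
  fixes p q p' q' :: int and A B :: real
  assumes q: "0 < q" "0 < q'" "q \<le> A" "q' \<le> B" and ne: "real_of_int p / q \<noteq> p' / q'"
  shows "1 / (A * B) \<le> \<bar>real_of_int p / q - p' / q'\<bar>"
proof -
  have diff: "real_of_int p / q - p' / q' = real_of_int (p * q' - p' * q) / (real_of_int q * q')"
    using q by (simp add: diff_frac_eq)
  have "p * q' - p' * q \<noteq> 0"
  proof
    assume "p * q' - p' * q = 0"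
    then have "real_of_int p / q - p' / q' = 0" unfolding diff by (simp only: of_int_0 div_0)
    then show False using ne by simp
  qed
  then have one: "1 \<le> \<bar>real_of_int (p * q' - p' * q)\<bar>" by linarith
  have "1 / (A * B) \<le> \<bar>real_of_int (p * q' - p' * q)\<bar> / (real_of_int q * q')"
  proof (rule frac_le)
    show "real_of_int q * q' \<le> A * B" using q by (intro mult_mono) auto
  qed (use q one in auto)
  also have "\<dots> = \<bar>real_of_int p / q - p' / q'\<bar>" unfolding diff using q by (simp add: abs_divide abs_mult)
  finally show ?thesis .
qed

section \<open>Lower bound for the full set\<close>

text \<open>
  A node \<open>(y, N, w)\<close> carries the ball of radius \<open>\<rho> N\<close> around \<open>y\<close> and the mass \<open>w\<close>. Its children sit at
  the fractions of \<open>fracs (nxt N)\<close> in the concentric ball of half the radius. There are at least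
  \<open>\<rho> N * (nxt N)\<^sup>2 / 8\<close> of them, at mutual distance of order at least \<open>1 / (nxt N)\<^sup>2\<close>, so they are spread over a
  length comparable to \<open>\<rho> N\<close>, that is \<open>N powr - (2 + \<beta>)\<close>. The weight condition becomes \<open>w * N powr \<sigma> \<le> 1\<close>
  with \<open>\<sigma> = (2 + \<beta>) * s < 2\<close>, and the invariant persists because \<open>(nxt N) powr \<sigma>\<close> is much smaller
  than the number of children when \<open>nxt N\<close> is large compared with \<open>N\<close>.

  A limit point is approximated by reduced fractions with growing denominators far better than
  a rational number can be, so it is irrational. Each centre is one of its convergents by
  Legendre's theorem, and the radius forces the next partial quotient to be large.
\<close>
lemma hausdorff_measure_J_nonzero:
  assumes \<beta>: "\<beta> > 0" and s0: "0 \<le> s" and s1: "s < 2 / (2 + \<beta>)"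
  shows "hausdorff_measure s (J \<beta>) \<noteq> 0"
proof -
  define \<sigma> where "\<sigma> = (2 + \<beta>) * s"
  have \<sigma>: "0 \<le> \<sigma>" "\<sigma> < 2" using \<beta> s0 s1 by (auto simp: \<sigma>_def field_simps)
  \<comment> \<open>For \<open>q \<le> 5 N\<close> this is at most \<open>1 / (4 * q powr (2 + \<beta>))\<close>; the factor 4 leaves room for the
      lower bound \<open>1 / ((a + 2) * q\<^sup>2)\<close> on the distance to a convergent.\<close>
  define \<rho> where "\<rho> N = 1 / (4 * (5 * real N) powr (2 + \<beta>))" for N :: nat
  have rho_pos: "\<rho> N > 0" if "1 \<le> N" for N using that by (simp add: \<rho>_def)
  have rho_small: "\<rho> N \<le> 1 / (100 * (real N)\<^sup>2)" if N: "1 \<le> N" for N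
  proof -
    have "(5 * real N)\<^sup>2 * 1 \<le> (5 * real N)\<^sup>2 * (5 * real N) powr \<beta>"
      using N \<beta> by (intro mult_left_mono ge_one_powr_ge_zero) auto
    also have "\<dots> = (5 * real N) powr (2 + \<beta>)" using N by (simp add: powr_add powr_numeral)
    finally have "100 * (real N)\<^sup>2 \<le> 4 * (5 * real N) powr (2 + \<beta>)" by (simp add: power_mult_distrib)
    then show ?thesis unfolding \<rho>_def using N by (intro divide_left_mono mult_pos_pos) auto
  qed
  \<comment> \<open>The requirements on the next scale: nested balls, at least two children,
      persistence of the weight invariant, and enough fractions in every interval of length \<open>\<rho> N\<close>.\<close>
  define good where "good N N' \<longleftrightarrow> N < N' \<and> \<rho> N' \<le> \<rho> N / 2 \<and> 16 \<le> \<rho> N * (real N')\<^sup>2 \<and>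
    8 * real N' powr \<sigma> \<le> \<rho> N * (real N')\<^sup>2 \<and>
    (\<forall>a. \<rho> N * (real N')\<^sup>2 / 8 \<le> card (fracs N' a (a + \<rho> N)))" for N N'
  have "\<exists>N'. good N N'" if "1 \<le> N" for N
  proof -
    define c where "c = \<rho> N"
    have c: "c > 0" unfolding c_def by (rule rho_pos[OF that])
    have "eventually (\<lambda>N'. N < N') sequentially" by (rule eventually_gt_at_top)
    moreover have "eventually (\<lambda>N'. \<rho> N' \<le> c / 2) sequentially"
      unfolding \<rho>_def using c \<beta> by real_asymp
    moreover have "eventually (\<lambda>N'. 16 \<le> c * (real N')\<^sup>2) sequentially"
      using c by real_asymp
    moreover have "eventually (\<lambda>N'. 8 * real N' powr \<sigma> \<le> c * (real N')\<^sup>2) sequentially"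
      using c \<sigma> by real_asymp
    moreover note fracs_card_eventually[OF c]
    ultimately have "eventually (\<lambda>N'. good N N') sequentially"
      unfolding good_def c_def by eventually_elim auto
    then show ?thesis by (auto simp: eventually_sequentially)
  qed
  then obtain nxt where nxt: "\<And>N. 1 \<le> N \<Longrightarrow> good N (nxt N)" by metis

  define F where "F = (\<lambda>(y::real, N::nat, w::real). fracs (nxt N) (y - \<rho> N / 2) (y - \<rho> N / 2 + \<rho> N))"
  define m where "m v = card (F v)" for v
  define I where "I = (\<lambda>(y::real, N::nat, w::real). cball y (\<rho> N))"
  define G where "G = (\<lambda>(y::real, N::nat, w::real). 1 \<le> N \<and> 0 < w \<and> w * real N powr \<sigma> \<le> 1 \<and> cball y (\<rho> N) \<subseteq> {0..1})"
  define child where "child v z = (case v of (y::real, N::nat, w::real) \<Rightarrow> (z::real, nxt N, w / m v))" for v z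
  define ch where "ch v = child v ` F v" for v
  define W where "W = (\<lambda>(y::real, N::nat, w::real). w)"
  define gap where "gap = (\<lambda>(y::real, N::nat, w::real). 1 / (50 * (real (nxt N))\<^sup>2))"
  define r :: "real \<times> nat \<times> real" where "r = (1/2, 1, 1)"
  define C where "C = (1600 * 5 powr (2 + \<beta>)) powr s"

  have F_eq: "F (y, N, w) = fracs (nxt N) (y - \<rho> N / 2) (y - \<rho> N / 2 + \<rho> N)" for y N w
    by (simp only: F_def prod.case)
  have inj: "inj_on (child v) (F v)" for v by (cases v) (auto simp: inj_on_def child_def)
  have card_ch: "card (ch v) = m v" for v unfolding ch_def m_def by (rule card_image[OF inj])
  have fF: "finite (F v)" if "G v" for v
  proof -
    obtain y N w where v: "v = (y, N, w)" by (cases v)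
    have "\<rho> N > 0" using that rho_pos by (simp add: G_def v)
    then show ?thesis unfolding v F_eq by (rule fracs_bounds(1))
  qed
  have m_ge: "\<rho> N * (real (nxt N))\<^sup>2 / 8 \<le> m (y, N, w)" if "1 \<le> N" for y N w
    using nxt[OF that] unfolding good_def m_def F_eq by blast
  have m2: "2 \<le> m (y, N, w)" if "1 \<le> N" for y N w
  proof -
    have "2 \<le> \<rho> N * (real (nxt N))\<^sup>2 / 8" using nxt[OF that] by (simp add: good_def)
    then have "2 \<le> real (m (y, N, w))" using m_ge[OF that, of y w] by linarith
    then show ?thesis by simp
  qed

  show ?thesis
  proof (rule separated_tree_hausdorff_measure_nonzero[where G = G and r = r and I = I and ch = ch
        and W = W and gap = gap and C = C])
    have "cball (1/2 :: real) (\<rho> 1) \<subseteq> {0..1}" using rho_small[of 1] by (auto simp: dist_real_def)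
    then show "G r" by (simp add: G_def r_def)
    show "W r > 0" by (simp add: W_def r_def)
    show "C > 0" by (simp add: C_def)
    show "0 \<le> s" by (rule s0)
    have "s * (2 + \<beta>) < 2" using \<sigma> by (simp add: \<sigma>_def mult.commute)
    moreover have "s * 2 \<le> s * (2 + \<beta>)" using s0 \<beta> by (intro mult_left_mono) auto
    ultimately show "s \<le> 1" by linarith
  next
    fix v assume G: "G v"
    obtain y N w where v: "v = (y, N, w)" by (cases v)
    have N: "1 \<le> N" and w: "0 < w" "w * real N powr \<sigma> \<le> 1" using G by (auto simp: v G_def)
    have N': "real (nxt N) > 0" using nxt[OF N] by (simp add: good_def)
    show "compact (I v) \<and> I v \<noteq> {}" using rho_pos[OF N] by (simp add: I_def v)
    show "finite (ch v) \<and> 2 \<le> card (ch v)"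
      unfolding card_ch using m2[OF N] fF[OF G] by (simp add: ch_def v)
    show "gap v > 0" using N' by (simp add: gap_def v)
    show "W v \<le> C * (gap v * card (ch v)) powr s"
    proof -
      have "\<rho> N / 400 = 1 / (50 * (real (nxt N))\<^sup>2) * (\<rho> N * (real (nxt N))\<^sup>2 / 8)"
        using N' by simp
      also have "\<dots> \<le> gap v * card (ch v)"
        unfolding card_ch using m_ge[OF N] by (simp only: gap_def v prod.case) (intro mult_left_mono, auto)
      finally have gm: "\<rho> N / 400 \<le> gap v * card (ch v)" .
      have "w \<le> 1 / real N powr \<sigma>" using N w by (simp add: field_simps)
      also have "\<dots> = (1 / real N powr (2 + \<beta>)) powr s" using N by (simp add: \<sigma>_def powr_divide powr_powr)
      also have "\<dots> = ((1600 * 5 powr (2 + \<beta>)) * (\<rho> N / 400)) powr s"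
        using N by (simp add: \<rho>_def powr_mult)
      also have "\<dots> = C * (\<rho> N / 400) powr s" unfolding C_def by (simp only: powr_mult)
      also have "\<dots> \<le> C * (gap v * card (ch v)) powr s"
        using gm s0 rho_pos[OF N] by (intro mult_left_mono powr_mono2) (auto simp: C_def)
      finally show ?thesis by (simp add: W_def v)
    qed
  next
    fix v c assume G: "G v" and c: "c \<in> ch v"
    obtain y N w where v: "v = (y, N, w)" by (cases v)
    obtain z where z: "z \<in> F v" and c_eq: "c = (z, nxt N, w / m v)" using c by (auto simp: ch_def child_def v)
    have N: "1 \<le> N" and w: "0 < w" "w * real N powr \<sigma> \<le> 1" and sub: "cball y (\<rho> N) \<subseteq> {0..1}"
      using G by (auto simp: v G_def)
    have g: "good N (nxt N)" by (rule nxt[OF N])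
    have m0: "real (m v) > 0" using m2[OF N, of y w] by (simp add: v)
    have "1 \<le> real N powr \<sigma>" using N \<sigma> by (intro ge_one_powr_ge_zero) auto
    then have "w * 1 \<le> w * real N powr \<sigma>" using w by (intro mult_left_mono) auto
    then have w1: "w \<le> 1" using w by linarith
    have "w * real (nxt N) powr \<sigma> \<le> 1 * (\<rho> N * (real (nxt N))\<^sup>2 / 8)"
      using g w1 w by (intro mult_mono) (auto simp: good_def)
    also have "\<dots> \<le> m v" using m_ge[OF N] by (simp add: v)
    finally have wc: "w / m v * real (nxt N) powr \<sigma> \<le> 1" using m0 by (simp add: field_simps)
    have "cball z (\<rho> (nxt N)) \<subseteq> cball y (\<rho> N)"
    proof
      fix x assume "x \<in> cball z (\<rho> (nxt N))"
      then have "\<bar>z - x\<bar> \<le> \<rho> N / 2" using g by (auto simp: dist_real_def good_def)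
      moreover have "y - \<rho> N / 2 \<le> z \<and> z \<le> y - \<rho> N / 2 + \<rho> N"
        using z unfolding v F_eq fracs_def by simp
      ultimately show "x \<in> cball y (\<rho> N)" unfolding mem_cball dist_real_def by linarith
    qed
    then have "G c" "I c \<subseteq> I v"
      using g N w m0 wc sub by (auto simp: G_def I_def c_eq v good_def)
    moreover have "W c = W v / card (ch v)" unfolding card_ch by (simp add: c_eq W_def v)
    ultimately show "G c \<and> I c \<subseteq> I v \<and> W c = W v / card (ch v)" by blast
  next
    fix v b c x x'
    assume G: "G v" and bc: "b \<in> ch v" "c \<in> ch v" "b \<noteq> c" and x: "x \<in> I b" and x': "x' \<in> I c"
    obtain y N w where v: "v = (y, N, w)" by (cases v)
    have N: "1 \<le> N" using G by (auto simp: v G_def)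
    define N' where "N' = nxt N"
    have N': "1 \<le> N'" using nxt[OF N] by (simp add: good_def N'_def)
    obtain z z' where z: "z \<in> F v" "z' \<in> F v" "b = child v z" "c = child v z'" "z \<noteq> z'"
      using bc by (auto simp: ch_def)
    obtain p q p' q' :: int where pq: "4 * int N' < q" "q \<le> 5 * int N'" "z = p / q"
      "4 * int N' < q'" "q' \<le> 5 * int N'" "z' = p' / q'"
      using z(1,2) by (auto simp: F_def fracs_def v N'_def)
    have q: "0 < real_of_int q" "real_of_int q \<le> 5 * N'" "0 < real_of_int q'" "real_of_int q' \<le> 5 * N'"
      using pq by linarith+
    have "1 / (5 * real N' * (5 * real N')) \<le> \<bar>z - z'\<bar>"
      using fraction_separation[of q q' "5 * real N'" "5 * real N'" p p'] q z(5) by (simp add: pq)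
    then have far: "1 / (25 * (real N')\<^sup>2) \<le> \<bar>z - z'\<bar>" by (simp add: power2_eq_square)
    have "\<bar>z - x\<bar> \<le> \<rho> N'" "\<bar>z' - x'\<bar> \<le> \<rho> N'"
      using x x' by (auto simp: z I_def child_def v N'_def dist_real_def)
    then have "\<bar>z - z'\<bar> - 2 * \<rho> N' \<le> \<bar>x - x'\<bar>" by linarith
    moreover have "gap v = 1 / (25 * (real N')\<^sup>2) - 2 * (1 / (100 * (real N')\<^sup>2))"
      by (simp add: gap_def v N'_def)
    ultimately show "gap v \<le> \<bar>x - x'\<bar>" using far rho_small[OF N'] by linarith
  next
    fix v x
    assume v0: "v 0 = r" and G: "\<And>k. G (v k)" and chain: "\<And>k. v (Suc k) \<in> ch (v k)"
      and x: "\<And>k. x \<in> I (v k)"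
    define N where "N k = fst (snd (v k))" for k
    define y where "y k = fst (v k)" for k
    have N1: "1 \<le> N k" for k using G[of k] by (cases "v k") (auto simp: G_def N_def)
    have NS: "N (Suc k) = nxt (N k)" for k
      using chain[of k] by (cases "v k") (auto simp: ch_def child_def N_def)
    have Nk: "k \<le> N k" for k
    proof (induction k)
      case (Suc k)
      have "N k < N (Suc k)" using nxt[OF N1[of k]] by (simp add: NS good_def)
      then show ?case using Suc by simp
    qed simp
    have "y (Suc k) \<in> F (v k)" for k
      using chain[of k] by (cases "v k") (auto simp: ch_def child_def y_def)
    moreover have "F (v k) = fracs (N (Suc k)) (y k - \<rho> (N k) / 2) (y k - \<rho> (N k) / 2 + \<rho> (N k))" for k
    proof -
      have "v k = (y k, N k, snd (snd (v k)))" by (simp add: y_def N_def)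
      then show ?thesis unfolding NS by (metis F_eq)
    qed
    ultimately have "y (Suc k) \<in> fracs (N (Suc k)) (y k - \<rho> (N k) / 2) (y k - \<rho> (N k) / 2 + \<rho> (N k))" for k
      by blast
    then have "\<exists>p q :: int. coprime p q \<and> 4 * int (N (Suc k)) < q \<and> q \<le> 5 * int (N (Suc k)) \<and> y (Suc k) = p / q" for k
      unfolding fracs_def by blast
    then obtain p q :: "nat \<Rightarrow> int" where pq: "\<And>k. coprime (p k) (q k)" "\<And>k. 4 * int (N (Suc k)) < q k"
      "\<And>k. q k \<le> 5 * int (N (Suc k))" "\<And>k. y (Suc k) = p k / q k" by metis
    have close: "\<bar>x - p k / q k\<bar> \<le> \<rho> (N (Suc k))" for k
      using x[of "Suc k"] by (cases "v (Suc k)") (auto simp: I_def N_def pq(4)[symmetric] y_def dist_real_def)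
    have qN: "4 * real (N (Suc k)) < q k" "q k \<le> 5 * real (N (Suc k))" for k
      using pq(2,3)[of k] by linarith+
    have x01: "0 \<le> x" "x \<le> 1" using x[of 0] G[of 0] by (auto simp: I_def G_def v0 r_def)
    \<comment> \<open>A centre with denominator above that of \<open>x = b / c\<close> differs from \<open>x\<close>, so its distance
        to \<open>x\<close> is too large for the radius.\<close>
    have irr: "x \<notin> \<rat>"
    proof
      assume "x \<in> \<rat>"
      then obtain b c where c: "c > 0" "coprime b c" "x = of_int b / of_int c"
        by (metis Rats_cases' )
      define k where "k = nat c"
      define n where "n = N (Suc k)"
      have cn: "real_of_int c \<le> n" using Nk[of "Suc k"] c by (simp add: k_def n_def)
      have n: "1 \<le> n" using N1 by (simp add: n_def)
      have q0: "real_of_int (q k) > 0" using qN[of k] by linarith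
      have "q k \<noteq> c" using qN(1)[of k] cn c by (auto simp: n_def)
      then have "x \<noteq> p k / q k"
        using coprime_fraction_eq[of b c "p k" "q k"] c pq(1)[of k] q0 by auto
      then have "1 / (real n * (5 * real n)) \<le> \<bar>x - p k / q k\<bar>"
        using fraction_separation[of c "q k" "real n" "5 * real n" b "p k"] c q0 cn qN(2)[of k]
        by (simp add: n_def)
      also have "\<dots> \<le> 1 / (100 * (real n)\<^sup>2)" using close[of k] rho_small[OF n] by (simp add: n_def)
      finally show False using n by (simp add: field_simps power2_eq_square)
    qed
    then have "x \<noteq> 1" by auto
    then have xin: "x \<in> {0..<1} - \<rat>" using x01 irr by auto
    define a where "a = (\<lambda>i. partial_quotient i x)"
    interpret cf_expansion x a "\<lambda>n. (gauss_map ^^ n) x"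
      unfolding a_def by (rule irrational_cf_expansion[OF xin])
    have ex: "\<exists>n. int (den a n) = q k \<and> real (cf_denom n x) powr \<beta> \<le> partial_quotient (n + 1) x" for k
    proof -
      define z where "z = real_of_int (q k)"
      have z1: "1 < z" using qN(1)[of k] N1[of "Suc k"] by (simp add: z_def)
      have zN: "z \<le> 5 * real (N (Suc k))" using qN by (simp add: z_def)
      have zb: "1 \<le> z powr \<beta>" using z1 \<beta> by (intro ge_one_powr_ge_zero) auto
      have z2: "z powr (2 + \<beta>) = z\<^sup>2 * z powr \<beta>" using z1 by (simp add: powr_add powr_numeral)
      have "\<rho> (N (Suc k)) \<le> 1 / (4 * z powr (2 + \<beta>))"
        unfolding \<rho>_def using z1 zN \<beta> by (intro divide_left_mono mult_left_mono powr_mono2 mult_pos_pos) auto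
      then have cl: "\<bar>x - p k / q k\<bar> \<le> 1 / (4 * (z\<^sup>2 * z powr \<beta>))" using close[of k] z2 by simp
      have "4 * (z\<^sup>2 * 1) \<le> 4 * (z\<^sup>2 * z powr \<beta>)" using zb by (intro mult_left_mono) auto
      moreover have "2 * z\<^sup>2 < 4 * (z\<^sup>2 * 1)" using z1 by simp
      ultimately have "2 * z\<^sup>2 < 4 * (z\<^sup>2 * z powr \<beta>)" by linarith
      then have "1 / (4 * (z\<^sup>2 * z powr \<beta>)) < 1 / (2 * z\<^sup>2)" using z1 by (intro divide_strict_left_mono) auto
      with cl have "\<bar>x - p k / q k\<bar> < 1 / (2 * (real_of_int (q k))\<^sup>2)" by (simp add: z_def)
      moreover have "q k > 0" using z1 by (simp add: z_def)
      ultimately obtain n where n: "int (num a n) = p k" "int (den a n) = q k"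
        using legendre_convergent pq(1) by blast
      have nz: "real (num a n) = p k" "real (den a n) = z" using n by (simp_all add: z_def flip: n)
      have "4 * (z\<^sup>2 * z powr \<beta>) \<le> (real (a (Suc n)) + 2) * z\<^sup>2"
      proof (rule inverse_le_imp_le)
        show "inverse ((real (a (Suc n)) + 2) * z\<^sup>2) \<le> inverse (4 * (z\<^sup>2 * z powr \<beta>))"
          using dist_convergent_ge[of n] cl unfolding nz by (simp add: inverse_eq_divide flip: z_def)
      qed (use z1 in simp)
      then have "z\<^sup>2 * (4 * z powr \<beta>) \<le> z\<^sup>2 * (real (a (Suc n)) + 2)" by (simp add: mult.commute mult.left_commute)
      then have "4 * z powr \<beta> \<le> real (a (Suc n)) + 2" using z1 by simp
      then have "z powr \<beta> \<le> a (Suc n)" using zb by linarith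
      then show ?thesis using n nz by (auto simp: cf_denom_eq partial_quotient_eq intro!: exI[of _ n])
    qed
    have "infinite {n. 1 \<le> n \<and> real (cf_denom n x) powr \<beta> \<le> partial_quotient (n + 1) x}"
      unfolding infinite_nat_iff_unbounded_le
    proof
      fix k0
      define k where "k = den a (Suc k0)"
      obtain n where n: "int (den a n) = q k" "real (cf_denom n x) powr \<beta> \<le> partial_quotient (n + 1) x"
        using ex by blast
      have "int k < q k" using pq(2)[of k] Nk[of "Suc k"] by linarith
      then have "k < den a n" using n(1) by linarith
      then have "den a (Suc k0) < den a n" unfolding k_def .
      then have "Suc k0 < n" using den_mono[of n "Suc k0"] by (meson not_le)
      then show "\<exists>n\<ge>k0. n \<in> {n. 1 \<le> n \<and> real (cf_denom n x) powr \<beta> \<le> partial_quotient (n + 1) x}"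
        using n by (intro exI[of _ n]) auto
    qed
    then show "x \<in> J \<beta>" using xin by (simp add: J_def)
  qed
qed

section \<open>The dimensions\<close>

lemma hausdorff_dim_J:
  assumes "\<beta> > 0"
  shows "hausdorff_dim (J \<beta>) = ennreal (2 / (2 + \<beta>))"
  using assms
  by (intro antisym hausdorff_dim_leI hausdorff_dim_geI hausdorff_measure_J_zero
      hausdorff_measure_J_nonzero) auto

lemma hausdorff_dim_J_star:
  assumes "\<beta> > 0"
  shows "hausdorff_dim (J_star \<beta>) = ennreal (1 / (2 + \<beta>))"
  using assms
  by (intro antisym hausdorff_dim_leI hausdorff_dim_geI hausdorff_measure_J_star_zero
      hausdorff_measure_J_star_nonzero) auto

theorem mainTheorem2:
  fixes \<beta> :: real
  assumes "\<beta> > 0"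
  shows "hausdorff_dim (J_star \<beta>) = ennreal (1 / (2 + \<beta>)) \<and>
         hausdorff_dim (J_star \<beta>) = hausdorff_dim (J \<beta>) / 2"
proof
  show star: "hausdorff_dim (J_star \<beta>) = ennreal (1 / (2 + \<beta>))"
    by (rule hausdorff_dim_J_star[OF assms])
  have "ennreal (2 / (2 + \<beta>)) / ennreal 2 = ennreal (2 / (2 + \<beta>) / 2)"
    using assms by (intro divide_ennreal) auto
  also have "2 / (2 + \<beta>) / 2 = 1 / (2 + \<beta>)"
    using assms by (simp add: field_simps)
  finally show "hausdorff_dim (J_star \<beta>) = hausdorff_dim (J \<beta>) / 2"
    by (simp add: star hausdorff_dim_J[OF assms])
qed

end
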